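(* There is a deterministic algorithm which, given two freely reduced words $v,w\in F(a,b)$ of length at most $n$, decides whether or not $v\equiv_c w$, that is, whether or not $v$ and $w$ are $\mathrm{SL}(2,\mathbb C)$-character equivalent, in deterministic Turing-machine time $O(n^5)$.
   Context: $F(a,b)$ is the free group on $a,b$; words are over $\{a,a^{-1},b,b^{-1}\}$. For $w\in F(a,b)$ and $A,B\in \mathrm{SL}(2,\mathbb C)$, $w(A,B)$ denotes the image of $w$ under $a\mapsto A$, $b\mapsto B$. Elements $v,w\in F(a,b)$ are $\mathrm{SL}(2,\mathbb C)$-character equivalent, written $v\equiv_c w$, if $\mathrm{Tr}(v(A,B))=\mathrm{Tr}(w(A,B))$ for all $A,B\in\mathrm{SL}(2,\mathbb C)$. *)

theory Defs
  imports "HOL-Analysis.Analysis" "HOL-Library.Landau_Symbols"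
begin

section \<open>Words in the free group on two generators\<close>

text \<open>
  An element of \<open>F(a,b)\<close> is represented by its unique freely reduced word. The evaluation below
  is defined on all words; by \<open>eval_word_cancel\<close> it is invariant under free reduction, so on
  reduced words it is the homomorphism \<open>F(a,b) \<rightarrow> SL(2,\<complex>)\<close> given by the images of \<open>a\<close> and \<open>b\<close>.
\<close>

datatype letter = Lit_a | Lit_a_inv | Lit_b | Lit_b_inv

type_synonym word = "letter list"

fun inv_letter :: "letter \<Rightarrow> letter" where
  "inv_letter Lit_a = Lit_a_inv"
| "inv_letter Lit_a_inv = Lit_a"
| "inv_letter Lit_b = Lit_b_inv"
| "inv_letter Lit_b_inv = Lit_b"

definition freely_reduced :: "word \<Rightarrow> bool" where
  "freely_reduced w \<longleftrightarrow> successively (\<lambda>x y. y \<noteq> inv_letter x) w"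

definition SL2C :: "(complex^2^2) set" where
  "SL2C = {A. det A = 1}"

fun eval_letter :: "complex^2^2 \<Rightarrow> complex^2^2 \<Rightarrow> letter \<Rightarrow> complex^2^2" where
  "eval_letter A B Lit_a = A"
| "eval_letter A B Lit_a_inv = matrix_inv A"
| "eval_letter A B Lit_b = B"
| "eval_letter A B Lit_b_inv = matrix_inv B"

fun eval_word :: "complex^2^2 \<Rightarrow> complex^2^2 \<Rightarrow> word \<Rightarrow> complex^2^2" where
  "eval_word A B [] = mat 1"
| "eval_word A B (x # w) = eval_letter A B x ** eval_word A B w"

definition char_equiv :: "word \<Rightarrow> word \<Rightarrow> bool" where
  "char_equiv v w \<longleftrightarrow>
     (\<forall>A\<in>SL2C. \<forall>B\<in>SL2C. trace (eval_word A B v) = trace (eval_word A B w))"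

lemma eval_word_append: "eval_word A B (u @ v) = eval_word A B u ** eval_word A B v"
  by (induction u) (simp_all add: matrix_mul_assoc)

lemma eval_word_cancel:
  assumes "A \<in> SL2C" "B \<in> SL2C"
  shows "eval_word A B (u @ [x, inv_letter x] @ v) = eval_word A B (u @ v)"
proof -
  have "M ** matrix_inv M = mat 1" "matrix_inv M ** M = mat 1"
    if "M \<in> SL2C" for M
  proof -
    have "\<exists>N. M ** N = mat 1 \<and> N ** M = mat 1"
      using that invertible_det_nz[of M] by (simp add: SL2C_def invertible_def)
    from someI_ex[OF this] show "M ** matrix_inv M = mat 1" "matrix_inv M ** M = mat 1"
      by (simp_all add: matrix_inv_def)
  qed
  note inv = this[OF assms(1)] this[OF assms(2)]
  have "eval_letter A B x ** eval_letter A B (inv_letter x) = mat 1"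
    by (cases x) (simp_all add: inv)
  then show ?thesis
    by (simp add: eval_word_append matrix_mul_assoc)
qed


section \<open>Deterministic multitape Turing machines\<close>

text \<open>
  A machine has a fixed number of two-way infinite tapes, states \<open>0, \<dots>, num_states - 1\<close> and tape
  symbols \<open>0, \<dots>, num_symbols - 1\<close>, where \<open>0\<close> is the blank. Only the values of \<open>delta\<close> on these
  finitely many states and symbols are relevant; see \<open>wf_tm\<close>.
\<close>

datatype move = Move_Left | Move_Right | No_Move

record tm =
  num_tapes :: nat
  num_states :: nat
  num_symbols :: nat
  start_state :: nat
  accept_state :: nat
  reject_state :: nat
  delta :: "nat \<Rightarrow> nat list \<Rightarrow> nat \<times> (nat \<times> move) list"

text \<open>
  The bound \<open>6 \<le> num_symbols\<close> makes room for the input alphabet: blank, the four letters, and a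
  separator.
\<close>

definition wf_tm :: "tm \<Rightarrow> bool" where
  "wf_tm M \<longleftrightarrow>
     1 \<le> num_tapes M \<and> 6 \<le> num_symbols M \<and>
     start_state M < num_states M \<and> accept_state M < num_states M \<and>
     reject_state M < num_states M \<and> accept_state M \<noteq> reject_state M \<and>
     (\<forall>q < num_states M. \<forall>xs. length xs = num_tapes M \<and> set xs \<subseteq> {..<num_symbols M} \<longrightarrow>
        (case delta M q xs of (q', acts) \<Rightarrow>
           q' < num_states M \<and> length acts = num_tapes M \<and>
           (\<forall>(s, d) \<in> set acts. s < num_symbols M)))"

datatype tape = Tape (cells: "int \<Rightarrow> nat") (head: int)

type_synonym config = "nat \<times> tape list"

definition read_tape :: "tape \<Rightarrow> nat" where
  "read_tape t = cells t (head t)"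

fun move_head :: "move \<Rightarrow> int \<Rightarrow> int" where
  "move_head Move_Left i = i - 1"
| "move_head Move_Right i = i + 1"
| "move_head No_Move i = i"

fun act_tape :: "nat \<times> move \<Rightarrow> tape \<Rightarrow> tape" where
  "act_tape (s, d) (Tape f i) = Tape (f(i := s)) (move_head d i)"

definition halted :: "tm \<Rightarrow> config \<Rightarrow> bool" where
  "halted M c \<longleftrightarrow> fst c \<in> {accept_state M, reject_state M}"

definition tm_step :: "tm \<Rightarrow> config \<Rightarrow> config" where
  "tm_step M c =
     (if halted M c then c
      else case delta M (fst c) (map read_tape (snd c)) of
        (q', acts) \<Rightarrow> (q', map2 act_tape acts (snd c)))"

definition input_tape :: "nat list \<Rightarrow> tape" where
  "input_tape xs = Tape (\<lambda>i. if 0 \<le> i \<and> nat i < length xs then xs ! nat i else 0) 0"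

definition init_config :: "tm \<Rightarrow> nat list \<Rightarrow> config" where
  "init_config M xs =
     (start_state M, input_tape xs # replicate (num_tapes M - 1) (input_tape []))"

definition answers_within :: "tm \<Rightarrow> nat list \<Rightarrow> bool \<Rightarrow> nat \<Rightarrow> bool" where
  "answers_within M xs b t \<longleftrightarrow>
     (\<exists>s \<le> t. fst ((tm_step M ^^ s) (init_config M xs)) =
               (if b then accept_state M else reject_state M))"

fun letter_code :: "letter \<Rightarrow> nat" where
  "letter_code Lit_a = 1"
| "letter_code Lit_a_inv = 2"
| "letter_code Lit_b = 3"
| "letter_code Lit_b_inv = 4"

definition encode_pair :: "word \<Rightarrow> word \<Rightarrow> nat list" where
  "encode_pair v w = map letter_code v @ [5] @ map letter_code w"

end

theory Submission
  imports Defs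
begin

text \<open>
  By the Cayley-Hamilton theorem, every \<open>w(A, B)\<close> is a combination of \<open>1, A, B, AB\<close> whose coefficients
  are integer polynomials in \<open>x = tr A\<close>, \<open>y = tr B\<close>, \<open>z = tr AB\<close>, and reading one more letter amounts to
  boundedly many operations \<open>f\<^sub>i += \<plusminus> {1, x, y, z} f\<^sub>j\<close>. After \<open>O(n)\<close> such operations the degrees
  are \<open>O(n)\<close> and the coefficients are \<open>2 ^ O(n)\<close> in absolute value. Since every \<open>(x, y, z)\<close> is realised by
  some pair \<open>A, B\<close>, character equivalence means that the difference of the two trace polynomials
  vanishes. By Kronecker substitution this happens iff its value at
  \<open>x = 2 ^ L\<close>, \<open>y = 2 ^ L\<^sup>2\<close>, \<open>z = 2 ^ L\<^sup>3\<close> is divisible by \<open>2 ^ L\<^sup>4\<close>, for a suitable \<open>L = O(n)\<close>. Computing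
  modulo \<open>2 ^ L\<^sup>4\<close>, each operation is a shifted addition or subtraction of binary numbers with \<open>L\<^sup>4\<close> digits,
  so the total time is \<open>O(n\<^sup>5)\<close>.
\<close>

section \<open>Trace coordinates as register operations\<close>

text \<open>
  The operation \<open>(i, j, k, s)\<close> adds \<open>\<plusminus> X k * V j\<close> to register \<open>i\<close>, with sign \<open>-\<close> if \<open>s\<close> holds. Here
  \<open>X 0 = 1\<close>, and \<open>X 1, X 2, X 3\<close> stand for the traces \<open>x, y, z\<close> of \<open>A\<close>, \<open>B\<close> and \<open>AB\<close>.
\<close>

type_synonym op = "nat \<times> nat \<times> nat \<times> bool"

definition sg :: "bool \<Rightarrow> int" where "sg b = (if b then - 1 else 1)"

definition op_app :: "(nat \<Rightarrow> 'a::comm_ring_1) \<Rightarrow> op \<Rightarrow> (nat \<Rightarrow> 'a) \<Rightarrow> nat \<Rightarrow> 'a" where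
  "op_app X = (\<lambda>(i, j, k, s) V. V(i := V i + of_int (sg s) * X k * V j))"

definition ops_app :: "(nat \<Rightarrow> 'a::comm_ring_1) \<Rightarrow> op list \<Rightarrow> (nat \<Rightarrow> 'a) \<Rightarrow> nat \<Rightarrow> 'a" where
  "ops_app X os = fold (op_app X) os"

definition op_ok :: "op \<Rightarrow> bool" where
  "op_ok = (\<lambda>(i, j, k, s). i < 9 \<and> j < 9 \<and> i \<noteq> j \<and> k < 4)"

definition op_inv :: "op \<Rightarrow> op" where
  "op_inv = (\<lambda>(i, j, k, s). (i, j, k, \<not> s))"

text \<open>
  If the registers \<open>b, \<dots>, b + 3\<close> hold the coordinates \<open>f\<^sub>1, \<dots>, f\<^sub>4\<close> of a matrix with respect to
  \<open>1, A, B, AB\<close>, then multiplying it by \<open>A\<close> on the right gives the coordinates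
  \<open>- f\<^sub>2 + (z - x y) f\<^sub>3 - y f\<^sub>4\<close>, \<open>f\<^sub>1 + x f\<^sub>2 + y f\<^sub>3 + z f\<^sub>4\<close>, \<open>x f\<^sub>3 + f\<^sub>4\<close>, \<open>- f\<^sub>3\<close>, because
  \<open>A\<^sup>2 = x A - 1\<close>, \<open>B A = z - x y + y A + x B - A B\<close> and \<open>A B A = z A + B - y\<close>. Multiplying it by \<open>B\<close>
  gives \<open>- f\<^sub>3\<close>, \<open>- f\<^sub>4\<close>, \<open>f\<^sub>1 + y f\<^sub>3\<close>, \<open>f\<^sub>2 + y f\<^sub>4\<close>. The groups of three operations with \<open>k = 0\<close>
  are signed swaps of two registers. Every operation is invertible, so the inverse letters
  run the same sequence backwards.
\<close>

definition a_ops :: "nat \<Rightarrow> op list" where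
  "a_ops b =
     [(b, b + 1, 1, False), (b, b + 2, 2, False), (b, b + 3, 3, False),
      (b + 3, b + 2, 1, False), (b + 1, b + 2, 3, True), (b + 1, b + 3, 2, False),
      (b, b + 1, 0, True), (b + 1, b, 0, False), (b, b + 1, 0, True),
      (b + 2, b + 3, 0, False), (b + 3, b + 2, 0, True), (b + 2, b + 3, 0, False)]"

definition b_ops :: "nat \<Rightarrow> op list" where
  "b_ops b =
     [(b, b + 2, 2, False), (b, b + 2, 0, True), (b + 2, b, 0, False), (b, b + 2, 0, True),
      (b + 1, b + 3, 2, False), (b + 1, b + 3, 0, True), (b + 3, b + 1, 0, False),
      (b + 1, b + 3, 0, True)]"

fun letter_ops :: "nat \<Rightarrow> letter \<Rightarrow> op list" where
  "letter_ops b Lit_a = a_ops b"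
| "letter_ops b Lit_a_inv = map op_inv (rev (a_ops b))"
| "letter_ops b Lit_b = b_ops b"
| "letter_ops b Lit_b_inv = map op_inv (rev (b_ops b))"

definition word_ops :: "nat \<Rightarrow> word \<Rightarrow> op list" where
  "word_ops b w = concat (map (letter_ops b) w)"

text \<open>The operation with multiplier \<open>X 0\<close> is listed twice because the identity
  matrix has trace 2.\<close>

definition trace_ops :: "nat \<Rightarrow> bool \<Rightarrow> op list" where
  "trace_ops b s = [(8, b, 0, s), (8, b, 0, s), (8, b + 1, 1, s), (8, b + 2, 2, s), (8, b + 3, 3, s)]"

text \<open>Registers \<open>0-3\<close> belong to \<open>v\<close>, \<open>4-7\<close> to \<open>w\<close>, and \<open>8\<close> collects the difference of the traces.\<close>

definition pair_ops :: "word \<Rightarrow> word \<Rightarrow> op list" where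
  "pair_ops v w = word_ops 0 v @ word_ops 4 w @ trace_ops 0 False @ trace_ops 4 True"

text \<open>Both blocks start with the coordinates of the identity matrix, the value of the empty
  word.\<close>

definition reg0 :: "nat \<Rightarrow> 'a::comm_ring_1" where
  "reg0 i = (if i = 0 \<or> i = 4 then 1 else 0)"

definition comb :: "complex^2^2 \<Rightarrow> complex^2^2 \<Rightarrow> nat \<Rightarrow> (nat \<Rightarrow> complex) \<Rightarrow> complex^2^2" where
  "comb A B b V = (\<chi> i j. V b * mat 1 $ i $ j + V (b + 1) * A $ i $ j + V (b + 2) * B $ i $ j
      + V (b + 3) * (A ** B) $ i $ j)"

definition char_point :: "complex^2^2 \<Rightarrow> complex^2^2 \<Rightarrow> nat \<Rightarrow> complex" where
  "char_point A B k =
     (if k = 0 then 1 else if k = 1 then trace A else if k = 2 then trace B else trace (A ** B))"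

lemma op_ok_letter:
  assumes "b \<in> {0, 4}" "p \<in> set (letter_ops b l)" shows "op_ok p"
  using assms by (cases l) (auto simp: op_ok_def op_inv_def a_ops_def b_ops_def)

lemma op_ok_pair: "p \<in> set (pair_ops v w) \<Longrightarrow> op_ok p"
  using op_ok_letter[of 0 p] op_ok_letter[of 4 p]
  by (auto simp: pair_ops_def word_ops_def trace_ops_def) (auto simp: op_ok_def)

lemma length_letter_ops: "length (letter_ops b l) \<le> 12"
  by (cases l) (auto simp: a_ops_def b_ops_def)

lemma length_word_ops: "length (word_ops b w) \<le> 12 * length w"
proof (induction w)
  case (Cons l w)
  then show ?case
    using length_letter_ops[of b l] by (simp add: word_ops_def)
qed (simp add: word_ops_def)

text \<open>At most 12 operations per letter and 10 for the traces stay below 16 per input cell, the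
  separator included. Strictness is what \<open>kronecker\<close> asks for in
  \<open>d < L\<close>.\<close>

lemma length_pair_ops: "length (pair_ops v w) < 16 * (length v + length w + 1)"
  using length_word_ops[of 0 v] length_word_ops[of 4 w]
  by (simp add: pair_ops_def trace_ops_def)

text \<open>An operation never changes the register it reads, as \<open>op_ok\<close> demands
  \<open>i \<noteq> j\<close>, so repeating it with the opposite sign cancels it.\<close>

lemma ops_app_inverse:
  "\<forall>p\<in>set os. op_ok p \<Longrightarrow> ops_app X os (ops_app X (map op_inv (rev os)) V) = V"
proof (induction os)
  case (Cons p os)
  have *: "op_app X p (op_app X (op_inv p) U) = U" for U
    using Cons.prems by (cases p) (auto simp: op_app_def op_inv_def op_ok_def sg_def)
  show ?case
    using Cons by (simp add: ops_app_def *)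
qed (simp add: ops_app_def)

text \<open>Compared entry by entry, both sides are polynomials in the entries of \<open>A\<close>
  and \<open>B\<close> and in the four registers; they agree modulo the determinant relations
  \<open>d\<close>.\<close>

lemma comb_letter_a:
  assumes "A \<in> SL2C" "B \<in> SL2C"
  shows "comb A B b (ops_app (char_point A B) (a_ops b) V) = comb A B b V ** A"
proof -
  define p q r s where "p = A$1$1" "q = A$1$2" "r = A$2$1" "s = A$2$2"
  define p' q' r' s' where "p' = B$1$1" "q' = B$1$2" "r' = B$2$1" "s' = B$2$2"
  have d: "p * s = 1 + q * r" "p' * s' = 1 + q' * r'"
    using assms by (simp_all add: SL2C_def det_2 p_q_r_s_def p'_q'_r'_s'_def algebra_simps)
  show ?thesis
    unfolding comb_def ops_app_def op_app_def char_point_def vec_eq_iff forall_2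
    apply (simp add: a_ops_def b_ops_def sg_def matrix_matrix_mult_def sum_2 mat_def trace_def flip: p_q_r_s_def p'_q'_r'_s'_def)
    using d apply (intro conjI; algebra)
    done
qed

lemma comb_letter_b:
  assumes "A \<in> SL2C" "B \<in> SL2C"
  shows "comb A B b (ops_app (char_point A B) (b_ops b) V) = comb A B b V ** B"
proof -
  define p q r s where "p = A$1$1" "q = A$1$2" "r = A$2$1" "s = A$2$2"
  define p' q' r' s' where "p' = B$1$1" "q' = B$1$2" "r' = B$2$1" "s' = B$2$2"
  have d: "p * s = 1 + q * r" "p' * s' = 1 + q' * r'"
    using assms by (simp_all add: SL2C_def det_2 p_q_r_s_def p'_q'_r'_s'_def algebra_simps)
  show ?thesis
    unfolding comb_def ops_app_def op_app_def char_point_def vec_eq_iff forall_2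
    apply (simp add: a_ops_def b_ops_def sg_def matrix_matrix_mult_def sum_2 mat_def trace_def flip: p_q_r_s_def p'_q'_r'_s'_def)
    using d apply (intro conjI; algebra)
    done
qed

lemma SL2C_inverse:
  assumes "M \<in> SL2C" shows "M ** matrix_inv M = mat 1"
proof -
  have "\<exists>N. M ** N = mat 1 \<and> N ** M = mat 1"
    using assms invertible_det_nz[of M] by (simp add: SL2C_def invertible_def)
  from someI_ex[OF this] show ?thesis by (simp add: matrix_inv_def)
qed

lemma comb_letter:
  assumes "A \<in> SL2C" "B \<in> SL2C" "b \<in> {0, 4}"
  shows "comb A B b (ops_app (char_point A B) (letter_ops b l) V) = comb A B b V ** eval_letter A B l"
proof -
  note ab = comb_letter_a[OF assms(1,2)] comb_letter_b[OF assms(1,2)]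
  \<comment> \<open>Inverse letters need no further matrix computation: the forward operations lead
    from \<open>?U\<close> back to \<open>V\<close>, so multiplying by the inverse of
    \<open>M\<close> isolates the matrix held by \<open>?U\<close>.\<close>
  have inv: "comb A B b (ops_app X (map op_inv (rev os)) V) = comb A B b V ** matrix_inv M"
    if "M \<in> SL2C" "\<forall>p\<in>set os. op_ok p" "\<And>V. comb A B b (ops_app X os V) = comb A B b V ** M" for M os X
  proof -
    let ?U = "ops_app X (map op_inv (rev os)) V"
    have "comb A B b V = comb A B b ?U ** M"
      using that(3)[of ?U] by (simp only: ops_app_inverse[OF that(2)])
    then show ?thesis
      using SL2C_inverse[OF that(1)] by (simp flip: matrix_mul_assoc)
  qed
  show ?thesis
    using op_ok_letter[OF assms(3), of _ Lit_a] op_ok_letter[OF assms(3), of _ Lit_b]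
    by (cases l) (simp_all add: ab inv assms)
qed

lemma comb_word:
  assumes "A \<in> SL2C" "B \<in> SL2C" "b \<in> {0, 4}"
  shows "comb A B b (ops_app (char_point A B) (word_ops b w) V) = comb A B b V ** eval_word A B w"
proof (induction w arbitrary: V)
  case (Cons l w)
  have "ops_app X (word_ops b (l # w)) V = ops_app X (word_ops b w) (ops_app X (letter_ops b l) V)"
    for X :: "nat \<Rightarrow> complex"
    by (simp add: ops_app_def word_ops_def)
  then show ?case
    by (simp add: Cons comb_letter[OF assms] matrix_mul_assoc)
qed (simp add: ops_app_def word_ops_def)

lemma ops_app_other:
  "\<forall>p\<in>set os. fst p \<noteq> i \<Longrightarrow> ops_app X os V i = V i"
  by (induction os arbitrary: V) (auto simp: ops_app_def op_app_def split: prod.splits)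

lemma letter_ops_target: "p \<in> set (letter_ops b l) \<Longrightarrow> b \<le> fst p \<and> fst p < b + 4"
  by (cases l) (auto simp: op_inv_def a_ops_def b_ops_def)

lemma word_ops_other: "i < b \<or> b + 4 \<le> i \<Longrightarrow> ops_app X (word_ops b w) V i = V i"
  by (rule ops_app_other) (auto simp: word_ops_def dest!: letter_ops_target)

lemma trace_comb:
  "trace (comb A B b V) = 2 * V b + trace A * V (b + 1) + trace B * V (b + 2) + trace (A ** B) * V (b + 3)"
  by (simp add: comb_def trace_def sum_2 mat_def algebra_simps)

lemma pair_ops_trace:
  assumes "A \<in> SL2C" "B \<in> SL2C"
  shows "ops_app (char_point A B) (pair_ops v w) reg0 8 =
     trace (eval_word A B v) - trace (eval_word A B w)"
proof -
  define X where "X = char_point A B"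
  define V where "V = ops_app X (word_ops 0 v) reg0"
  define W where "W = ops_app X (word_ops 4 w) V"
  have one: "comb A B b U = mat 1" if "U b = 1" "U (b + 1) = 0" "U (b + 2) = 0" "U (b + 3) = 0" for U b
    using that by (simp add: comb_def vec_eq_iff)
  have "comb A B 0 W = comb A B 0 V"
    by (simp add: comb_def W_def word_ops_other)
  also have "\<dots> = eval_word A B v"
    by (simp add: V_def X_def comb_word[OF assms] one reg0_def)
  finally have v: "comb A B 0 W = eval_word A B v" .
  have "comb A B 4 V = mat 1"
    by (rule one) (simp_all add: V_def word_ops_other reg0_def)
  then have w: "comb A B 4 W = eval_word A B w"
    by (simp add: W_def X_def comb_word[OF assms])
  have "W 8 = 0"
    by (simp add: W_def V_def word_ops_other reg0_def)
  moreover have "ops_app X (pair_ops v w) reg0 = ops_app X (trace_ops 0 False @ trace_ops 4 True) W"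
    by (simp add: pair_ops_def ops_app_def W_def V_def)
  ultimately have "ops_app X (pair_ops v w) reg0 8 = trace (comb A B 0 W) - trace (comb A B 4 W)"
    by (simp add: trace_comb trace_ops_def ops_app_def op_app_def sg_def X_def char_point_def algebra_simps)
  then show ?thesis
    by (simp add: v w X_def)
qed

lemma exists_SL2C_with_traces:
  obtains A B where "A \<in> SL2C" "B \<in> SL2C" "trace A = x" "trace B = y" "trace (A ** B) = z"
proof -
  \<comment> \<open>\<open>c\<close> is a root of \<open>c^2 - z c + 1\<close>, so that
    \<open>det B = c (z - c) = 1\<close>. The matrix \<open>A\<close> is a companion matrix with
    trace \<open>x\<close>, and \<open>A ** B\<close> is upper triangular with diagonal
    \<open>z - c\<close>, \<open>c\<close>.\<close>
  define c where "c = (z + csqrt (z\<^sup>2 - 4)) / 2"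
  have c: "c * (z - c) = 1"
    using power2_csqrt[of "z\<^sup>2 - 4"] by (simp add: c_def field_simps power2_eq_square)
  define A :: "complex^2^2" where "A = vector [vector [x, - 1], vector [1, 0]]"
  define B :: "complex^2^2" where "B = vector [vector [0, c], vector [c - z, y]]"
  show ?thesis
  proof
    show "A \<in> SL2C" "B \<in> SL2C"
      using c by (simp_all add: SL2C_def det_2 A_def B_def algebra_simps)
  qed (simp_all add: trace_def sum_2 A_def B_def matrix_matrix_mult_def)
qed


section \<open>Kronecker substitution\<close>

text \<open>
  A polynomial is a list of monomials \<open>(c, i, j, k)\<close>, read as \<open>c x\<^sup>i y\<^sup>j z\<^sup>k\<close>. Like monomials are never
  merged, so the length of the list bounds every coefficient when \<open>c = \<plusminus> 1\<close>.
\<close>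

type_synonym mono = "int \<times> nat \<times> nat \<times> nat"

definition mono_eval :: "(nat \<Rightarrow> 'a::comm_ring_1) \<Rightarrow> mono \<Rightarrow> 'a" where
  "mono_eval X = (\<lambda>(c, i, j, k). of_int c * X 1 ^ i * X 2 ^ j * X 3 ^ k)"

definition mono_mult :: "nat \<Rightarrow> bool \<Rightarrow> mono \<Rightarrow> mono" where
  "mono_mult m s = (\<lambda>(c, i, j, k).
     (sg s * c, i + of_bool (m = 1), j + of_bool (m = 2), k + of_bool (m = 3)))"

definition poly_eval :: "(nat \<Rightarrow> 'a::comm_ring_1) \<Rightarrow> mono list \<Rightarrow> 'a" where
  "poly_eval X ms = sum_list (map (mono_eval X) ms)"

definition sym_op :: "op \<Rightarrow> (nat \<Rightarrow> mono list) \<Rightarrow> nat \<Rightarrow> mono list" where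
  "sym_op = (\<lambda>(i, j, k, s) P. P(i := P i @ map (mono_mult k s) (P j)))"

definition sym_reg0 :: "nat \<Rightarrow> mono list" where
  "sym_reg0 i = (if i = 0 \<or> i = 4 then [(1, 0, 0, 0)] else [])"

lemma mono_eval_mult:
  assumes "X 0 = 1" "m < 4"
  shows "mono_eval X (mono_mult m s p) = of_int (sg s) * X m * mono_eval X p"
proof -
  consider "m = 0" | "m = 1" | "m = 2" | "m = 3" using assms(2) by linarith
  then show ?thesis
    using assms(1) by cases (auto simp: mono_eval_def mono_mult_def split: prod.splits)
qed

lemma poly_eval_sym_op:
  assumes "X 0 = 1" "op_ok p"
  shows "poly_eval X (sym_op p P i) = op_app X p (\<lambda>i. poly_eval X (P i)) i"
  using assms
  by (cases p) (auto simp: sym_op_def op_app_def op_ok_def poly_eval_def mono_eval_mult o_def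
      sum_list_const_mult)

text \<open>The symbolic run can be evaluated in any commutative ring, so one integer polynomial
  accounts for the complex trace points and for the integer Kronecker point alike.\<close>

lemma poly_eval_fold_sym_op:
  assumes "X 0 = 1" "\<forall>p\<in>set os. op_ok p"
  shows "poly_eval X (fold sym_op os P i) = ops_app X os (\<lambda>i. poly_eval X (P i)) i"
  using assms(2)
proof (induction os arbitrary: P)
  case (Cons p os)
  have "(\<lambda>i. poly_eval X (sym_op p P i)) = op_app X p (\<lambda>i. poly_eval X (P i))"
    using Cons.prems by (intro ext poly_eval_sym_op assms(1)) simp
  then show ?case
    using Cons by (simp add: ops_app_def)
qed (simp add: ops_app_def)

definition bounded_monos :: "nat \<Rightarrow> mono list \<Rightarrow> bool" where
  "bounded_monos d ms \<longleftrightarrow> length ms \<le> 2 ^ d \<and> (\<forall>(c, i, j, k)\<in>set ms. \<bar>c\<bar> \<le> 1 \<and> i \<le> d \<and> j \<le> d \<and> k \<le> d)"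

text \<open>One operation appends a copy of one list to another: the length at most doubles and
  exponents grow by at most one, so a single \<open>d\<close> controls both.\<close>

lemma bounded_fold_sym_op:
  "\<forall>i. bounded_monos d (P i) \<Longrightarrow> bounded_monos (d + length os) (fold sym_op os P i)"
proof (induction os arbitrary: P d)
  case (Cons p os)
  have "bounded_monos (Suc d) (sym_op p P i)" for i
  proof -
    obtain a b k s where p: "p = (a, b, k, s)" by (cases p)
    have *: "\<And>i. length (P i) \<le> 2 ^ d"
      "\<And>i c x y z. (c, x, y, z) \<in> set (P i) \<Longrightarrow> \<bar>c\<bar> \<le> 1 \<and> x \<le> d \<and> y \<le> d \<and> z \<le> d"
      using Cons.prems by (fastforce simp: bounded_monos_def)+
    show ?thesis
      using *(1)[of i] *(1)[of b] 
      by (auto simp: bounded_monos_def sym_op_def p mono_mult_def abs_mult sg_def of_bool_def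
          dest!: *(2) intro: le_SucI)
  qed
  then show ?case
    using Cons.IH[of "Suc d" "sym_op p P"] by simp
qed simp

text \<open>The lowest nonzero coefficient would be a nonzero multiple of \<open>K\<close>.\<close>

lemma digits_zero:
  fixes K :: int and c :: "nat \<Rightarrow> int"
  assumes "\<And>m. \<bar>c m\<bar> < K" "K ^ M dvd (\<Sum>m<M. c m * K ^ m)" "m < M"
  shows "c m = 0"
  using assms
proof (induction M arbitrary: c m)
  case (Suc M)
  have K: "K > 0" using Suc.prems(1)[of 0] by linarith
  have sum: "(\<Sum>m<Suc M. c m * K ^ m) = c 0 + K * (\<Sum>m<M. c (Suc m) * K ^ m)"
    unfolding sum.lessThan_Suc_shift by (simp add: sum_distrib_left algebra_simps)
  have "K dvd c 0 + K * (\<Sum>m<M. c (Suc m) * K ^ m)"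
    using Suc.prems(2) unfolding sum by (metis dvd_mult_left power_Suc)
  then have "K dvd c 0" by (simp add: dvd_add_left_iff)
  then have c0: "c 0 = 0"
    using Suc.prems(1)[of 0] by (meson dvd_imp_le_int not_less abs_ge_self order_trans)
  then have "K ^ M dvd (\<Sum>m<M. c (Suc m) * K ^ m)"
    using Suc.prems(2) K unfolding sum by simp
  then have "c (Suc m) = 0" if "m < M" for m
    using Suc.IH[of "\<lambda>m. c (Suc m)"] Suc.prems(1) that by blast
  then show ?case
    using c0 Suc.prems(3) by (cases m) auto
qed simp

text \<open>Collects like terms: list entries with the same Kronecker exponent are gathered into one
  coefficient.\<close>

lemma sum_list_by_index:
  fixes h :: "'b \<Rightarrow> 'a::comm_ring_1" and g :: "'b \<Rightarrow> nat"
  assumes "\<forall>p\<in>set ms. g p < M"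
  shows "(\<Sum>p\<leftarrow>ms. h p * F (g p)) = (\<Sum>m<M. (\<Sum>p\<leftarrow>ms. if g p = m then h p else 0) * F m)"
  using assms
proof (induction ms)
  case (Cons p ms)
  have "h p * F (g p) = (\<Sum>m<M. (if m = g p then h p * F m else 0))"
    using Cons.prems by (simp add: sum.delta)
  also have "\<dots> = (\<Sum>m<M. (if g p = m then h p else 0) * F m)"
    by (intro sum.cong) auto
  finally have *: "h p * F (g p) = \<dots>" .
  show ?case
    using Cons by (simp add: * distrib_right sum.distrib)
qed simp

definition kron_index :: "nat \<Rightarrow> mono \<Rightarrow> nat" where
  "kron_index D = (\<lambda>(c, i, j, k). i + D * (j + D * k))"

lemma kron_index_less:
  fixes i j k D :: nat
  assumes "i < D" "j < D" "k < D"
  shows "i + D * (j + D * k) < D ^ 3"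
proof -
  have a: "x + D * y < D * m" if "x < D" "y < m" for x y m :: nat
  proof -
    have "x + D * y < D * Suc y" using that by simp
    also have "\<dots> \<le> D * m" using that by (intro mult_left_mono) auto
    finally show ?thesis .
  qed
  show ?thesis
    using a[OF assms(1) a[OF assms(2,3)]] by (simp add: power3_eq_cube)
qed

text \<open>The case \<open>k = 0\<close> is separate because the multiplier \<open>X 0\<close> has
  to be 1, whereas \<open>2 ^ (L ^ 0)\<close> is 2.\<close>

definition kron_point :: "nat \<Rightarrow> nat \<Rightarrow> int" where
  "kron_point L k = (if k = 0 then 1 else 2 ^ (L ^ k))"

text \<open>With \<open>K = 2 ^ L\<close> the value is the sum of \<open>c m * K ^ m\<close> over
  \<open>m < L ^ 3\<close>, where the \<open>c m\<close> are at most \<open>2 ^ d < K\<close> in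
  absolute value, and the modulus is \<open>K ^ (L ^ 3)\<close>. By \<open>digits_zero\<close> all
  collected coefficients vanish, hence so does the value at every point of every commutative
  ring.\<close>

lemma kronecker:
  fixes X :: "nat \<Rightarrow> 'a::comm_ring_1"
  assumes "bounded_monos d ms" "d < L" "2 ^ (L ^ 4) dvd poly_eval (kron_point L) ms"
  shows "poly_eval X ms = 0"
proof -
  define c where "c m = (\<Sum>p\<leftarrow>ms. if kron_index L p = m then fst p else 0)" for m
  have idx: "\<forall>p\<in>set ms. kron_index L p < L ^ 3"
    using assms(1,2) by (fastforce simp: bounded_monos_def kron_index_def intro!: kron_index_less)
  have "\<bar>c m\<bar> \<le> int (length ms)" for m
  proof -
    have "\<bar>c m\<bar> \<le> (\<Sum>p\<leftarrow>ms. \<bar>if kron_index L p = m then fst p else 0\<bar>)"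
      unfolding c_def by (rule order_trans[OF sum_list_abs]) (simp add: o_def)
    also have "\<dots> \<le> (\<Sum>p\<leftarrow>ms. 1)"
      using assms(1) by (intro sum_list_mono) (auto simp: bounded_monos_def)
    finally show ?thesis by (simp add: sum_list_triv)
  qed
  moreover have "int (length ms) < 2 ^ L"
  proof -
    have "length ms \<le> 2 ^ d" using assms(1) by (simp add: bounded_monos_def)
    also have "(2::nat) ^ d < 2 ^ L" using assms(2) by simp
    finally show ?thesis by (metis of_nat_less_iff of_nat_numeral of_nat_power)
  qed
  ultimately have small: "\<bar>c m\<bar> < 2 ^ L" for m
    by (meson le_less_trans)
  have "L ^ 2 = L * L" "L ^ 3 = L * (L * L)"
    by (simp_all add: power2_eq_square power3_eq_cube mult.assoc)
  then have pt: "kron_point L 1 = 2 ^ L" "kron_point L 2 = (2 ^ L) ^ L" "kron_point L 3 = (2 ^ L) ^ (L * L)"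
    by (simp_all only: kron_point_def power_mult) auto
  have "mono_eval (kron_point L) p = fst p * (2 ^ L) ^ kron_index L p" for p
  proof -
    obtain e i j k where p: "p = (e, i, j, k)" by (cases p)
    have "i + L * (j + L * k) = i + L * j + L * L * k"
      by (simp add: distrib_left mult.assoc)
    then have "((2::int) ^ L) ^ (i + L * (j + L * k)) = (2 ^ L) ^ i * ((2 ^ L) ^ L) ^ j * ((2 ^ L) ^ (L * L)) ^ k"
      by (simp only: power_add power_mult)
    then show ?thesis
      unfolding p mono_eval_def kron_index_def prod.case pt by simp
  qed
  then have "mono_eval (kron_point L) = (\<lambda>p. fst p * (2 ^ L) ^ kron_index L p)"
    by blast
  then have ev: "poly_eval (kron_point L) ms = (\<Sum>m<L ^ 3. c m * (2 ^ L) ^ m)"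
    unfolding poly_eval_def c_def
    using sum_list_by_index[OF idx, of fst "\<lambda>m. (2 ^ L) ^ m"] by simp
  have "L ^ 4 = L * L ^ 3" by (simp add: eval_nat_numeral)
  then have "(2::int) ^ (L ^ 4) = (2 ^ L) ^ (L ^ 3)"
    by (simp only: power_mult)
  then have "(2 ^ L) ^ (L ^ 3) dvd (\<Sum>m<L ^ 3. c m * (2 ^ L) ^ m)"
    using assms(3) by (simp only: ev)
  then have c0: "c m = 0" if "m < L ^ 3" for m
    by (rule digits_zero[OF small _ that])
  \<comment> \<open>As \<open>i, j < L\<close>, the three exponents can be read off the index as its
    base \<open>L\<close> digits.\<close>
  define F where "F m = X 1 ^ (m mod L) * X 2 ^ (m div L mod L) * X 3 ^ (m div L div L)" for m
  have "mono_eval X p = of_int (fst p) * F (kron_index L p)" if "p \<in> set ms" for p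
  proof -
    obtain e i j k where p: "p = (e, i, j, k)" by (cases p)
    have "i < L" "j < L"
      using that assms(1,2) by (fastforce simp: bounded_monos_def p)+
    then show ?thesis
      by (simp add: mono_eval_def kron_index_def F_def p mult.assoc)
  qed
  then have "poly_eval X ms = (\<Sum>p\<leftarrow>ms. of_int (fst p) * F (kron_index L p))"
    unfolding poly_eval_def by (intro arg_cong[of _ _ sum_list] map_cong) auto
  also have "\<dots> = (\<Sum>m<L ^ 3. (\<Sum>p\<leftarrow>ms. if kron_index L p = m then of_int (fst p) else 0) * F m)"
    by (rule sum_list_by_index[OF idx])
  also have "\<dots> = (\<Sum>m<L ^ 3. of_int (c m) * F m)"
  proof -
    have "(\<Sum>p\<leftarrow>ms. if kron_index L p = m then of_int (fst p) else (0::'a)) = of_int (c m)" for m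
      unfolding c_def by (induction ms) auto
    then show ?thesis by simp
  qed
  also have "\<dots> = 0" using c0 by simp
  finally show ?thesis .
qed

section \<open>Character equivalence as one integer divisibility\<close>

definition size_param :: "word \<Rightarrow> word \<Rightarrow> nat" where
  "size_param v w = 16 * (length v + length w + 1)"

text \<open>Forwards, matrices whose traces are the integers of the Kronecker point show that the
  integer value is 0, not just divisible. Backwards, \<open>kronecker\<close> applies because the
  number of operations bounds the degrees and lies below \<open>L\<close>.\<close>

lemma char_equiv_iff_dvd:
  fixes v w :: word
  defines "L \<equiv> size_param v w"
  shows "char_equiv v w \<longleftrightarrow> 2 ^ (L ^ 4) dvd ops_app (kron_point L) (pair_ops v w) reg0 8"
proof -
  define P where "P = fold sym_op (pair_ops v w) sym_reg0 8"
  have reg0: "(\<lambda>i. poly_eval X (sym_reg0 i)) = reg0" for X :: "nat \<Rightarrow> 'a::comm_ring_1"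
    by (auto simp: sym_reg0_def reg0_def poly_eval_def mono_eval_def)
  have ok: "\<forall>p\<in>set (pair_ops v w). op_ok p"
    using op_ok_pair by blast
  have ev: "poly_eval X P = ops_app X (pair_ops v w) reg0 8" if "X 0 = 1" for X :: "nat \<Rightarrow> 'a::comm_ring_1"
    unfolding P_def by (simp add: poly_eval_fold_sym_op[where X = X, OF that ok] reg0)
  have tr: "poly_eval (char_point A B) P = trace (eval_word A B v) - trace (eval_word A B w)"
    if "A \<in> SL2C" "B \<in> SL2C" for A B
    using ev[of "char_point A B"] pair_ops_trace[OF that, of v w] by (simp add: char_point_def)
  have evK: "poly_eval (kron_point L) P = ops_app (kron_point L) (pair_ops v w) reg0 8"
    by (rule ev) (simp add: kron_point_def)
  show ?thesis
  proof
    assume c: "char_equiv v w"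
    obtain A B where AB: "A \<in> SL2C" "B \<in> SL2C" "trace A = of_int (kron_point L 1)"
      "trace B = of_int (kron_point L 2)" "trace (A ** B) = of_int (kron_point L 3)"
      by (rule exists_SL2C_with_traces)
    have m: "of_int (mono_eval (kron_point L) p) = mono_eval (char_point A B) p" for p
      by (cases p) (simp add: mono_eval_def char_point_def AB)
    have "of_int (poly_eval (kron_point L) ms) = poly_eval (char_point A B) ms" for ms
      by (induction ms) (simp_all add: poly_eval_def m)
    then have "of_int (poly_eval (kron_point L) P) = poly_eval (char_point A B) P" .
    also have "\<dots> = 0"
      using tr c AB by (simp add: char_equiv_def)
    finally show "2 ^ (L ^ 4) dvd ops_app (kron_point L) (pair_ops v w) reg0 8"
      by (simp add: evK)
  next
    assume d: "2 ^ (L ^ 4) dvd ops_app (kron_point L) (pair_ops v w) reg0 8"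
    have "bounded_monos (0 + length (pair_ops v w)) P"
      unfolding P_def by (rule bounded_fold_sym_op) (simp add: bounded_monos_def sym_reg0_def)
    moreover have "0 + length (pair_ops v w) < L"
      using length_pair_ops by (simp add: L_def size_param_def)
    ultimately have "poly_eval (char_point A B) P = 0" for A B
      by (rule kronecker) (simp add: evK d)
    then show "char_equiv v w"
      using tr by (simp add: char_equiv_def)
  qed
qed


section \<open>Structured programs and their compilation\<close>

text \<open>Infinitely many tapes avoid any bookkeeping of lengths; \<open>conf\<close> later cuts a
  store down to its first \<open>k\<close> tapes.\<close>

type_synonym store = "nat \<Rightarrow> tape"
type_synonym reads = "nat \<Rightarrow> nat"

datatype prog =
    Put nat "reads \<Rightarrow> nat" move
  | Seq prog prog
  | Cond "reads \<Rightarrow> bool" prog prog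
  | While "reads \<Rightarrow> bool" prog

definition rd :: "store \<Rightarrow> reads" where
  "rd s i = read_tape (s i)"

text \<open>The time is the exact number of compiled instructions executed: a test costs 1, and so
  does the jump over the else branch or back to the loop test.\<close>

inductive exec :: "prog \<Rightarrow> store \<Rightarrow> nat \<Rightarrow> store \<Rightarrow> bool" where
  Put: "exec (Put i f d) s 1 (s(i := act_tape (f (rd s), d) (s i)))"
| Seq: "exec p s t s' \<Longrightarrow> exec q s' t' s'' \<Longrightarrow> exec (Seq p q) s (t + t') s''"
| Cond_True: "b (rd s) \<Longrightarrow> exec p s t s' \<Longrightarrow> exec (Cond b p q) s (t + 2) s'"
| Cond_False: "\<not> b (rd s) \<Longrightarrow> exec q s t s' \<Longrightarrow> exec (Cond b p q) s (1 + t) s'"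
| While_False: "\<not> b (rd s) \<Longrightarrow> exec (While b p) s 1 s"
| While_True: "b (rd s) \<Longrightarrow> exec p s t s' \<Longrightarrow> exec (While b p) s' t' s'' \<Longrightarrow>
    exec (While b p) s (t + 2 + t') s''"

fun wf_prog :: "nat \<Rightarrow> nat \<Rightarrow> prog \<Rightarrow> bool" where
  "wf_prog k S (Put i f d) \<longleftrightarrow> i < k \<and> (\<forall>r. (\<forall>i. r i < S) \<longrightarrow> f r < S)"
| "wf_prog k S (Seq p q) \<longleftrightarrow> wf_prog k S p \<and> wf_prog k S q"
| "wf_prog k S (Cond b p q) \<longleftrightarrow> wf_prog k S p \<and> wf_prog k S q"
| "wf_prog k S (While b p) \<longleftrightarrow> wf_prog k S p"

type_synonym instr = "reads \<Rightarrow> nat \<times> (nat \<Rightarrow> nat \<times> move)"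

abbreviation stay :: "reads \<Rightarrow> nat \<Rightarrow> nat \<times> move" where
  "stay r \<equiv> \<lambda>i. (r i, No_Move)"

fun psize :: "prog \<Rightarrow> nat" where
  "psize (Put i f d) = 1"
| "psize (Seq p q) = psize p + psize q"
| "psize (Cond b p q) = psize p + psize q + 2"
| "psize (While b p) = psize p + 2"

fun code :: "nat \<Rightarrow> prog \<Rightarrow> instr list" where
  "code a (Put i f d) = [\<lambda>r. (a + 1, (stay r)(i := (f r, d)))]"
| "code a (Seq p q) = code a p @ code (a + psize p) q"
| "code a (Cond b p q) =
     [\<lambda>r. (if b r then a + 1 else a + psize p + 2, stay r)] @ code (a + 1) p @
     [\<lambda>r. (a + psize p + psize q + 2, stay r)] @ code (a + psize p + 2) q"
| "code a (While b p) =
     [\<lambda>r. (if b r then a + 1 else a + psize p + 2, stay r)] @ code (a + 1) p @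
     [\<lambda>r. (a, stay r)]"

lemma length_code [simp]: "length (code a p) = psize p"
  by (induction p arbitrary: a) auto

definition instr_step :: "instr list \<Rightarrow> nat \<times> store \<Rightarrow> nat \<times> store" where
  "instr_step P = (\<lambda>(q, s). if q < length P
     then (fst ((P ! q) (rd s)), \<lambda>i. act_tape (snd ((P ! q) (rd s)) i) (s i)) else (q, s))"

definition code_at :: "instr list \<Rightarrow> nat \<Rightarrow> instr list \<Rightarrow> bool" where
  "code_at P a C \<longleftrightarrow> (\<exists>pre post. P = pre @ C @ post \<and> length pre = a)"

lemma code_at_append: "code_at P a (C @ D) \<longleftrightarrow> code_at P a C \<and> code_at P (a + length C) D"
proof
  assume "code_at P a (C @ D)"
  then obtain pre post where "P = pre @ C @ D @ post" "length pre = a"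
    by (auto simp: code_at_def)
  then show "code_at P a C \<and> code_at P (a + length C) D"
    unfolding code_at_def by (metis append.assoc length_append)
next
  assume "code_at P a C \<and> code_at P (a + length C) D"
  then obtain pre post pre' post' where P: "P = pre @ C @ post" "length pre = a"
    "P = pre' @ D @ post'" "length pre' = a + length C"
    unfolding code_at_def by blast
  then have "(pre @ C) @ post = pre' @ (D @ post')" "length (pre @ C) = length pre'"
    by simp_all
  then have "pre' = pre @ C" by (metis append_eq_append_conv)
  then have "P = pre @ (C @ D) @ post'" using P by simp
  with P(2) show "code_at P a (C @ D)"
    unfolding code_at_def by blast
qed

lemma code_at_Cons: "code_at P a (c # C) \<longleftrightarrow> code_at P a [c] \<and> code_at P (a + 1) C"
  using code_at_append[of P a "[c]" C] by simp

lemma instr_step_code_at: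
  "code_at P a [c] \<Longrightarrow> instr_step P (a, s) = (fst (c (rd s)), \<lambda>i. act_tape (snd (c (rd s)) i) (s i))"
  by (auto simp: code_at_def instr_step_def)

lemma act_tape_stay [simp]: "act_tape (rd s i, No_Move) (s i) = s i"
  by (cases "s i") (simp add: rd_def read_tape_def)

lemma funpow_compose_apply: "(f ^^ m) x = y \<Longrightarrow> (f ^^ n) y = z \<Longrightarrow> (f ^^ (m + n)) x = z"
  by (metis add.commute comp_apply funpow_add)

text \<open>Control enters a fragment at its first instruction and leaves it just behind its last
  one, so the runs of consecutive fragments can be chained.\<close>

lemma exec_code:
  "exec p s t s' \<Longrightarrow> code_at P a (code a p) \<Longrightarrow> (instr_step P ^^ t) (a, s) = (a + psize p, s')"
proof (induction arbitrary: a rule: exec.induct)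
  case (Put i f d s)
  have "(\<lambda>j. act_tape (if j = i then (f (rd s), d) else (rd s j, No_Move)) (s j)) =
    s(i := act_tape (f (rd s), d) (s i))"
    by auto
  then show ?case
    using Put by (simp add: instr_step_code_at fun_upd_def)
next
  case (Seq p s t s' q t' s'')
  then have "(instr_step P ^^ t) (a, s) = (a + psize p, s')"
    "(instr_step P ^^ t') (a + psize p, s') = (a + psize p + psize q, s'')"
    by (auto simp: code_at_append)
  then show ?case
    by (simp add: funpow_compose_apply add.assoc)
next
  case (Cond_True b s p t s' q)
  then have "(instr_step P ^^ 1) (a, s) = (a + 1, s)"
    "(instr_step P ^^ t) (a + 1, s) = (a + 1 + psize p, s')"
    "(instr_step P ^^ 1) (a + 1 + psize p, s') = (a + psize (Cond b p q), s')"
    by (auto simp: code_at_append code_at_Cons[of _ _ _ "_ @ _"] code_at_Cons[of _ _ _ "code _ _"]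
        instr_step_code_at ac_simps)
  from funpow_compose_apply[OF funpow_compose_apply[OF this(1,2)] this(3)] show ?case
    by (simp add: ac_simps)
next
  case (Cond_False b s q t s' p)
  then have "(instr_step P ^^ 1) (a, s) = (a + psize p + 2, s)"
    "(instr_step P ^^ t) (a + psize p + 2, s) = (a + psize p + 2 + psize q, s')"
    by (auto simp: code_at_append code_at_Cons[of _ _ _ "_ @ _"] code_at_Cons[of _ _ _ "code _ _"]
        instr_step_code_at ac_simps eval_nat_numeral)
  from funpow_compose_apply[OF this] show ?case
    by (simp add: ac_simps)
next
  case (While_False b s p)
  then show ?case
    by (auto simp: code_at_Cons[of _ _ _ "_ @ _"] instr_step_code_at)
next
  case (While_True b s p t s' t' s'')
  then have "(instr_step P ^^ 1) (a, s) = (a + 1, s)"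
    "(instr_step P ^^ t) (a + 1, s) = (a + 1 + psize p, s')"
    "(instr_step P ^^ 1) (a + 1 + psize p, s') = (a, s')"
    "(instr_step P ^^ t') (a, s') = (a + psize (While b p), s'')"
    by (auto simp: code_at_append code_at_Cons[of _ _ _ "_ @ _"] code_at_Cons[of _ _ _ "code _ _"]
        instr_step_code_at ac_simps)
  from funpow_compose_apply[OF funpow_compose_apply[OF funpow_compose_apply[OF this(1,2)] this(3)] this(4)]
  show ?case
    by (simp add: ac_simps)
qed

section \<open>From compiled code to a Turing machine\<close>

definition tape_reads :: "nat list \<Rightarrow> reads" where
  "tape_reads xs i = (if i < length xs then xs ! i else 0)"

text \<open>Running off the end of the code leads to state \<open>psize p\<close>, which gives the
  verdict: a blank under the head of tape \<open>f\<close> means acceptance. This costs one extra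
  step.\<close>

definition machine :: "nat \<Rightarrow> nat \<Rightarrow> nat \<Rightarrow> prog \<Rightarrow> tm" where
  "machine k S f p =
     \<lparr>num_tapes = k, num_states = psize p + 3, num_symbols = S, start_state = 0,
      accept_state = psize p + 1, reject_state = psize p + 2,
      delta = (\<lambda>q xs.
        if q < psize p then
          (case (code 0 p ! q) (tape_reads xs) of (q', acts) \<Rightarrow> (q', map acts [0..<k]))
        else (if tape_reads xs f = 0 then psize p + 1 else psize p + 2, map (stay (tape_reads xs)) [0..<k]))\<rparr>"

lemma machine_simps:
  "num_tapes (machine k S f p) = k" "num_states (machine k S f p) = psize p + 3"
  "num_symbols (machine k S f p) = S" "start_state (machine k S f p) = 0"
  "accept_state (machine k S f p) = psize p + 1" "reject_state (machine k S f p) = psize p + 2"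
  by (simp_all add: machine_def)

lemma code_wf:
  assumes "wf_prog k S p" "q < psize p" "\<forall>i. r i < S"
  shows "fst ((code a p ! q) r) \<le> a + psize p" "fst (snd ((code a p ! q) r) i) < S"
proof -
  have "fst ((code a p ! q) r) \<le> a + psize p \<and> fst (snd ((code a p ! q) r) i) < S"
    using assms
  proof (induction p arbitrary: a q)
    case (Seq p1 p2)
    show ?case
    proof (cases "q < psize p1")
      case True
      with Seq.IH(1)[of q a] Seq.prems show ?thesis by (auto simp: nth_append)
    next
      case False
      with Seq.IH(2)[of "q - psize p1" "a + psize p1"] Seq.prems show ?thesis
        by (auto simp: nth_append add.assoc)
    qed
  next
    case (Cond b p1 p2)
    consider "q = 0" | "0 < q" "q < psize p1 + 1" | "q = psize p1 + 1" | "psize p1 + 1 < q"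
      by linarith
    then show ?case
    proof cases
      case 2
      with Cond.IH(1)[of "q - 1" "a + 1"] Cond.prems show ?thesis
        by (auto simp: nth_append nth_Cons')
    next
      case 4
      then have "q - 1 - psize p1 - 1 = q - (psize p1 + 2)" by simp
      with 4 Cond.IH(2)[of "q - (psize p1 + 2)" "a + psize p1 + 2"] Cond.prems show ?thesis
        by (auto simp: nth_append nth_Cons' add.assoc)
    qed (use Cond.prems in \<open>auto simp: nth_append nth_Cons'\<close>)
  next
    case (While b p)
    consider "q = 0" | "0 < q" "q < psize p + 1" | "q = psize p + 1"
      using While.prems by fastforce
    then show ?case
    proof cases
      case 2
      with While.IH[of "q - 1" "a + 1"] While.prems show ?thesis
        by (auto simp: nth_append nth_Cons')
    qed (use While.prems in \<open>auto simp: nth_append nth_Cons'\<close>)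
  qed auto
  then show "fst ((code a p ! q) r) \<le> a + psize p" "fst (snd ((code a p ! q) r) i) < S"
    by auto
qed

text \<open>Tapes from \<open>k\<close> on are never altered, which justifies dropping them from the
  configuration.\<close>

lemma code_stay:
  "wf_prog k S p \<Longrightarrow> q < psize p \<Longrightarrow> k \<le> i \<Longrightarrow> snd ((code a p ! q) r) i = (r i, No_Move)"
proof (induction p arbitrary: a q)
  case (Seq p1 p2)
  show ?case
  proof (cases "q < psize p1")
    case True
    with Seq show ?thesis by (auto simp: nth_append)
  next
    case False
    with Seq.IH(2)[of "q - psize p1" "a + psize p1"] Seq.prems show ?thesis
      by (auto simp: nth_append)
  qed
next
  case (Cond b p1 p2)
  consider "q = 0" | "0 < q" "q < psize p1 + 1" | "q = psize p1 + 1" | "psize p1 + 1 < q"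
    by linarith
  then show ?case
  proof cases
    case 4
    then have "q - 1 - psize p1 - 1 = q - (psize p1 + 2)" by simp
    with 4 Cond.IH(2)[of "q - (psize p1 + 2)" "a + psize p1 + 2"] Cond.prems show ?thesis
      by (auto simp: nth_append nth_Cons')
  qed (use Cond in \<open>auto simp: nth_append nth_Cons'\<close>)
next
  case (While b p)
  consider "q = 0" | "0 < q" "q < psize p + 1" | "q = psize p + 1"
    using While.prems by fastforce
  then show ?case
    by cases (use While in \<open>auto simp: nth_append nth_Cons'\<close>)
qed auto

lemma wf_machine:
  assumes "wf_prog k S p" "1 \<le> k" "6 \<le> S"
  shows "wf_tm (machine k S f p)"
proof -
  have "q' < psize p + 3 \<and> length acts = k \<and> (\<forall>(s, d) \<in> set acts. s < S)"
    if "set xs \<subseteq> {..<S}" and D: "delta (machine k S f p) q xs = (q', acts)" for q xs q' acts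
  proof -
    have r: "\<forall>i. tape_reads xs i < S"
      using that(1) assms(3) by (auto simp: tape_reads_def subset_eq all_set_conv_all_nth)
    show ?thesis
    proof (cases "q < psize p")
      case True
      have "q' = fst ((code 0 p ! q) (tape_reads xs))"
        "acts = map (snd ((code 0 p ! q) (tape_reads xs))) [0..<k]"
        using D True by (auto simp: machine_def split: prod.splits)
      then show ?thesis
        using code_wf(1)[OF assms(1) True r, of 0] code_wf(2)[OF assms(1) True r, of 0]
        by (auto simp: case_prod_beta)
    next
      case False
      then show ?thesis
        using D r by (auto simp: machine_def)
    qed
  qed
  then have "case delta (machine k S f p) q xs of (q', acts) \<Rightarrow>
      q' < psize p + 3 \<and> length acts = k \<and> (\<forall>(s, d) \<in> set acts. s < S)"
    if "set xs \<subseteq> {..<S}" for q xs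
    using that by fast
  then show ?thesis
    using assms(2,3) by (simp add: wf_tm_def machine_simps)
qed

definition conf :: "nat \<Rightarrow> nat \<times> store \<Rightarrow> config" where
  "conf k = (\<lambda>(q, s). (q, map s [0..<k]))"

text \<open>The default 0 of \<open>tape_reads\<close> is the blank, which is what the dropped tapes
  show.\<close>

lemma tape_reads_map:
  "\<forall>i\<ge>k. rd s i = 0 \<Longrightarrow> tape_reads (map read_tape (map s [0..<k])) = rd s"
  by (auto simp: tape_reads_def rd_def fun_eq_iff)

lemma machine_step:
  assumes "wf_prog k S p" "q < psize p" "\<forall>i\<ge>k. rd s i = 0"
  shows "tm_step (machine k S f p) (conf k (q, s)) = conf k (instr_step (code 0 p) (q, s))"
    and "\<forall>i\<ge>k. rd (snd (instr_step (code 0 p) (q, s))) i = 0"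
proof -
  let ?M = "machine k S f p"
  have d: "delta ?M q (map read_tape (map s [0..<k])) =
    (fst ((code 0 p ! q) (rd s)), map (snd ((code 0 p ! q) (rd s))) [0..<k])"
    using assms(2) unfolding machine_def
    by (simp add: tape_reads_map[OF assms(3)] split: prod.splits del: map_map)
  have "\<not> halted ?M (conf k (q, s))"
    using assms(2) by (simp add: halted_def conf_def machine_def)
  then show "tm_step ?M (conf k (q, s)) = conf k (instr_step (code 0 p) (q, s))"
    using assms(2) unfolding tm_step_def conf_def
    by (simp add: d instr_step_def map2_map_map del: map_map)
  have "\<forall>i\<ge>k. act_tape (snd ((code 0 p ! q) (rd s)) i) (s i) = s i"
    using code_stay[OF assms(1,2)] by simp
  then show "\<forall>i\<ge>k. rd (snd (instr_step (code 0 p) (q, s))) i = 0"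
    using assms(2,3) by (simp add: instr_step_def rd_def)
qed

text \<open>Only some \<open>t' \<le> t\<close> is claimed: behind the end of the code
  \<open>instr_step\<close> idles, whereas the machine goes on to its verdict.\<close>

lemma machine_steps:
  assumes "wf_prog k S p"
  shows "\<lbrakk>\<forall>i\<ge>k. rd s i = 0; (instr_step (code 0 p) ^^ t) (q, s) = (psize p, s')\<rbrakk> \<Longrightarrow>
    \<exists>t'\<le>t. (tm_step (machine k S f p) ^^ t') (conf k (q, s)) = conf k (psize p, s') \<and> (\<forall>i\<ge>k. rd s' i = 0)"
proof (induction t arbitrary: q s)
  case (Suc t)
  show ?case
  proof (cases "q < psize p")
    case True
    note st = machine_step(1)[OF assms True Suc.prems(1), of f] machine_step(2)[OF assms True Suc.prems(1)]
    obtain q1 s1 where 1: "instr_step (code 0 p) (q, s) = (q1, s1)" by fastforce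
    have "(instr_step (code 0 p) ^^ t) (q1, s1) = (psize p, s')"
      using Suc.prems(2) by (simp add: funpow_swap1 1)
    with Suc.IH[of s1 q1] st obtain t' where "t' \<le> t"
      "(tm_step (machine k S f p) ^^ t') (conf k (q1, s1)) = conf k (psize p, s')" "\<forall>i\<ge>k. rd s' i = 0"
      by (auto simp: 1)
    then show ?thesis
      by (intro exI[of _ "Suc t'"]) (simp add: funpow_swap1 st 1)
  next
    case False
    then have "(instr_step (code 0 p) ^^ n) (q, s) = (q, s)" for n
      by (induction n) (auto simp: instr_step_def)
    from this[of "Suc t"] have "q = psize p" "s = s'"
      using Suc.prems(2) by simp_all
    then show ?thesis
      using Suc.prems by (intro exI[of _ 0]) auto
  qed
qed auto

lemma machine_answers:
  assumes "wf_prog k S p" "1 \<le> k" "f < k"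
    and "exec p (\<lambda>i. if i = 0 then input_tape xs else input_tape []) t s'"
  shows "answers_within (machine k S f p) xs (rd s' f = 0) (t + 1)"
proof -
  let ?M = "machine k S f p"
  define s :: store where "s = (\<lambda>i. if i = 0 then input_tape xs else input_tape [])"
  have "code_at (code 0 p) 0 (code 0 p)"
    by (simp add: code_at_def)
  then have "(instr_step (code 0 p) ^^ t) (0, s) = (psize p, s')"
    using exec_code[of p s t s' "code 0 p" 0] assms(4) by (simp add: s_def)
  moreover have "\<forall>i\<ge>k. rd s i = 0"
    using assms(2) by (simp add: s_def rd_def read_tape_def input_tape_def)
  ultimately obtain t' where t': "t' \<le> t"
    "(tm_step ?M ^^ t') (conf k (0, s)) = conf k (psize p, s')" "\<forall>i\<ge>k. rd s' i = 0"
    using machine_steps[OF assms(1)] by blast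
  have init: "init_config ?M xs = conf k (0, s)"
    using assms(2)
    by (auto simp: init_config_def conf_def machine_def s_def intro!: nth_equalityI
        simp: nth_Cons' )
  have "\<not> halted ?M (conf k (psize p, s'))"
    by (simp add: halted_def conf_def machine_def)
  then have "fst (tm_step ?M (conf k (psize p, s'))) =
    (if rd s' f = 0 then accept_state ?M else reject_state ?M)"
    unfolding tm_step_def conf_def
    by (simp add: machine_def tape_reads_map[OF t'(3)] del: map_map)
  then have "fst ((tm_step ?M ^^ Suc t') (init_config ?M xs)) =
    (if rd s' f = 0 then accept_state ?M else reject_state ?M)"
    by (simp add: init t')
  then show ?thesis
    unfolding answers_within_def using t'(1) by (intro exI[of _ "Suc t'"]) auto
qed


section \<open>Loops over rulers and binary addition\<close>

definition runs :: "prog \<Rightarrow> store \<Rightarrow> nat \<Rightarrow> store \<Rightarrow> bool" where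
  "runs p s T s' \<longleftrightarrow> (\<exists>t\<le>T. exec p s t s')"

lemma runsI: "exec p s t s' \<Longrightarrow> t \<le> T \<Longrightarrow> runs p s T s'"
  by (auto simp: runs_def)

lemma runsE:
  assumes "runs p s T s'" obtains t where "t \<le> T" "exec p s t s'"
  using assms by (auto simp: runs_def)

lemma runs_Put: "s' = s(i := act_tape (f (rd s), d) (s i)) \<Longrightarrow> 1 \<le> T \<Longrightarrow> runs (Put i f d) s T s'"
  using runsI[OF exec.Put] by simp

lemma runs_Seq: "runs p s T s' \<Longrightarrow> runs q s' T' s'' \<Longrightarrow> T + T' \<le> U \<Longrightarrow> runs (Seq p q) s U s''"
  by (elim runsE, rule runsI, rule exec.Seq, assumption+) linarith

lemma runs_Cond_True: "b (rd s) \<Longrightarrow> runs p s T s' \<Longrightarrow> T + 2 \<le> U \<Longrightarrow> runs (Cond b p q) s U s'"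
  by (elim runsE, rule runsI, rule exec.Cond_True, assumption+) linarith

lemma runs_Cond_False: "\<not> b (rd s) \<Longrightarrow> runs q s T s' \<Longrightarrow> T + 1 \<le> U \<Longrightarrow> runs (Cond b p q) s U s'"
  by (elim runsE, rule runsI, rule exec.Cond_False, assumption+) linarith

lemma runs_While_False: "\<not> b (rd s) \<Longrightarrow> 1 \<le> T \<Longrightarrow> runs (While b p) s T s"
  by (rule runsI[OF exec.While_False])

lemma runs_While_True:
  "b (rd s) \<Longrightarrow> runs p s T s' \<Longrightarrow> runs (While b p) s' T' s'' \<Longrightarrow> T + 2 + T' \<le> U \<Longrightarrow>
    runs (While b p) s U s''"
  by (elim runsE, rule runsI, rule exec.While_True, assumption+) linarith

lemma runs_mono: "runs p s T s' \<Longrightarrow> T \<le> U \<Longrightarrow> runs p s U s'"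
  by (elim runsE, rule runsI, assumption) linarith

text \<open>The stores \<open>g 0, ..., g n\<close> seen at the loop test take the place of an
  invariant; each round pays 2 for test and jump, the failing test 1.\<close>

lemma runs_While_iterate:
  assumes "\<And>m. m < n \<Longrightarrow> b (rd (g m))" "\<not> b (rd (g n))"
    and "\<And>m. m < n \<Longrightarrow> runs p (g m) T (g (Suc m))"
  shows "runs (While b p) (g 0) (n * (T + 2) + 1) (g n)"
  using assms
proof (induction n arbitrary: g)
  case 0
  then show ?case by (intro runs_While_False) auto
next
  case (Suc n)
  have "runs (While b p) (g (Suc 0)) (n * (T + 2) + 1) (g (Suc n))"
  proof (rule Suc.IH[of "\<lambda>m. g (Suc m)"])
    show "b (rd (g (Suc m)))" "runs p (g (Suc m)) T (g (Suc (Suc m)))" if "m < n" for m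
      using that by (simp_all only: Suc.prems(1,3) Suc_less_eq)
    show "\<not> b (rd (g (Suc n)))" by (rule Suc.prems(2))
  qed
  then show ?case
    by (rule runs_While_True[where b = b and s = "g 0", OF Suc.prems(1)[OF zero_less_Suc]
          Suc.prems(3)[OF zero_less_Suc]]) simp
qed

definition Mv :: "nat \<Rightarrow> move \<Rightarrow> prog" where
  "Mv i d = Put i (\<lambda>r. r i) d"

lemma runs_Mv:
  assumes "s i = Tape f h" "s' = s(i := Tape f (move_head d h))" "1 \<le> T"
  shows "runs (Mv i d) s T s'"
  unfolding Mv_def using assms by (intro runs_Put) (auto simp: rd_def read_tape_def)

definition Skip :: prog where
  "Skip = Mv 0 No_Move"

lemma runs_Skip: "1 \<le> T \<Longrightarrow> runs Skip s T s"
  unfolding Skip_def by (cases "s 0") (rule runs_Mv, assumption, simp_all add: fun_upd_idem)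

text \<open>The first move is unconditional: after a full pass the head stands on the blank behind
  the strip, where the scan would stop at once.\<close>

definition Rewind :: "nat \<Rightarrow> prog" where
  "Rewind i = Seq (Mv i Move_Left) (Seq (While (\<lambda>r. r i \<noteq> 0) (Mv i Move_Left)) (Mv i Move_Right))"

definition strip :: "(int \<Rightarrow> nat) \<Rightarrow> nat \<Rightarrow> bool" where
  "strip f n \<longleftrightarrow> (\<forall>j. f j \<noteq> 0 \<longleftrightarrow> 0 \<le> j \<and> j < int n)"

lemma runs_Rewind:
  assumes "strip f n" "h \<le> n" "s i = Tape f (int h)" "s' = s(i := Tape f 0)" "3 * h + 3 \<le> T"
  shows "runs (Rewind i) s T s'"
proof -
  define g where "g m = s(i := Tape f (int h - 1 - int m))" for m
  have 1: "runs (Mv i Move_Left) s 1 (g 0)"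
    by (rule runs_Mv) (simp_all add: assms(3) g_def)
  have 2: "runs (While (\<lambda>r. r i \<noteq> 0) (Mv i Move_Left)) (g 0) (h * (1 + 2) + 1) (g h)"
  proof (rule runs_While_iterate[where g = g and n = h])
    show "rd (g m) i \<noteq> 0" if "m < h" for m
      using assms(1,2) that by (simp add: g_def strip_def rd_def read_tape_def)
    show "\<not> rd (g h) i \<noteq> 0"
      using assms(1) by (simp add: g_def strip_def rd_def read_tape_def)
    show "runs (Mv i Move_Left) (g m) 1 (g (Suc m))" for m
      by (rule runs_Mv[where f = f and h = "int h - 1 - int m"]) (simp_all add: g_def algebra_simps)
  qed
  have 3: "runs (Mv i Move_Right) (g h) 1 s'"
    by (rule runs_Mv[where f = f and h = "- 1"]) (simp_all add: g_def assms(4))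
  show ?thesis
    unfolding Rewind_def
    by (rule runs_Seq[OF 1 runs_Seq[OF 2 3 order_refl]]) (use assms(5) in simp)
qed

definition For :: "nat \<Rightarrow> prog \<Rightarrow> prog" where
  "For i p = Seq (While (\<lambda>r. r i \<noteq> 0) (Seq p (Mv i Move_Right))) (Rewind i)"

text \<open>The strip is a unary loop counter. The body must leave its head in place, since the loop
  itself advances it. Each round pays 3 for test, jump and advance, and 3 more for rewinding one
  cell.\<close>

lemma runs_For:
  assumes f: "strip f n" and g: "\<And>m. m \<le> n \<Longrightarrow> g m i = Tape f (int m)"
    and body: "\<And>m. m < n \<Longrightarrow> runs p (g m) T ((g (Suc m))(i := Tape f (int m)))"
    and s: "s = g 0" "s' = (g n)(i := Tape f 0)"
    and U: "n * (T + 6) + 4 \<le> U"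
  shows "runs (For i p) s U s'"
proof -
  have "runs (While (\<lambda>r. r i \<noteq> 0) (Seq p (Mv i Move_Right))) (g 0) (n * (T + 1 + 2) + 1) (g n)"
  proof (rule runs_While_iterate[where g = g and n = n])
    fix m assume m: "m < n"
    then show "rd (g m) i \<noteq> 0"
      using f g[of m] by (auto simp: strip_def rd_def read_tape_def)
    have "g (Suc m) = ((g (Suc m))(i := Tape f (int m)))(i := Tape f (move_head Move_Right (int m)))"
      using m g[of "Suc m"] by (simp add: fun_upd_idem add.commute)
    then have "runs (Mv i Move_Right) ((g (Suc m))(i := Tape f (int m))) 1 (g (Suc m))"
      by (rule runs_Mv[OF fun_upd_same]) simp
    then show "runs (Seq p (Mv i Move_Right)) (g m) (T + 1) (g (Suc m))"
      by (rule runs_Seq[OF body[OF m] _ order_refl])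
  next
    show "\<not> rd (g n) i \<noteq> 0"
      using f g[of n] by (auto simp: strip_def rd_def read_tape_def)
  qed
  then show ?thesis
    unfolding For_def s
    by (rule runs_Seq[OF _ runs_Rewind[where s = "g n", OF f order_refl g[OF order_refl] refl order_refl]])
       (use U in \<open>simp add: algebra_simps\<close>)
qed

definition ruler :: "nat \<Rightarrow> int \<Rightarrow> nat" where
  "ruler n j = (if 0 \<le> j \<and> j < int n then 1 else 0)"

lemma strip_ruler [simp]: "strip (ruler n) n"
  by (auto simp: strip_def ruler_def)

lemma ruler_0: "ruler 0 = (\<lambda>_. 0)"
  by (auto simp: ruler_def)

lemma ruler_Suc: "(ruler n)(int n := 1) = ruler (Suc n)"
  by (auto simp: ruler_def)

fun pushes :: "nat \<Rightarrow> nat \<Rightarrow> prog" where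
  "pushes i 0 = Skip"
| "pushes i (Suc n) = Seq (Put i (\<lambda>_. 1) Move_Right) (pushes i n)"

lemma runs_pushes:
  assumes "s i = Tape (ruler k) (int k)" "s' = s(i := Tape (ruler (k + n)) (int (k + n)))" "n + 1 \<le> T"
  shows "runs (pushes i n) s T s'"
  using assms
proof (induction n arbitrary: k s T)
  case 0
  then show ?case by (auto intro!: runs_Skip simp: fun_upd_idem)
next
  case (Suc n)
  let ?s = "s(i := Tape (ruler (Suc k)) (int (Suc k)))"
  have 1: "runs (Put i (\<lambda>_. 1) Move_Right) s 1 ?s"
    using Suc.prems(1) by (intro runs_Put) (auto simp: ruler_Suc[simplified] add.commute)
  have "runs (pushes i n) ?s (n + 1) s'"
    by (rule Suc.IH[where k = "Suc k"]) (use Suc.prems in auto)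
  with 1 show ?case
    using Suc.prems(3) by (auto intro: runs_Seq)
qed

definition MulRuler :: "nat \<Rightarrow> nat \<Rightarrow> nat \<Rightarrow> prog" where
  "MulRuler a b c = Seq (For a (For b (pushes c 1))) (Rewind c)"

lemma runs_MulRuler:
  assumes abc: "a \<noteq> b" "b \<noteq> c" "a \<noteq> c"
    and s: "s a = Tape (ruler n) 0" "s b = Tape (ruler m) 0" "s c = Tape (ruler 0) 0"
    and s': "s' = s(c := Tape (ruler (n * m)) 0)"
    and pos: "1 \<le> n" "1 \<le> m" "40 * (n * m) \<le> T"
  shows "runs (MulRuler a b c) s T s'"
proof -
  define g where "g k = s(a := Tape (ruler n) (int k), c := Tape (ruler (k * m)) (int (k * m)))" for k
  have inner: "runs (For b (pushes c 1)) (g k) (8 * m + 4) ((g (Suc k))(a := Tape (ruler n) (int k)))" for k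
  proof -
    define h where "h j = (g k)(b := Tape (ruler m) (int j), c := Tape (ruler (k * m + j)) (int (k * m + j)))" for j
    show ?thesis
    proof (rule runs_For[where f = "ruler m" and n = m and T = 2 and g = h])
      show "h j b = Tape (ruler m) (int j)" for j using abc by (simp add: h_def)
      show "runs (pushes c 1) (h j) 2 ((h (Suc j))(b := Tape (ruler m) (int j)))" for j
        by (rule runs_pushes[where k = "k * m + j"]) (use abc in \<open>auto simp: h_def fun_eq_iff\<close>)
      show "g k = h 0" using abc s by (auto simp: g_def h_def fun_eq_iff)
      show "(g (Suc k))(a := Tape (ruler n) (int k)) = (h m)(b := Tape (ruler m) 0)"
        using abc s by (auto simp: g_def h_def fun_eq_iff add.commute)
    qed auto
  qed
  have "runs (For a (For b (pushes c 1))) s (n * (8 * m + 4 + 6) + 4) ((g n)(a := Tape (ruler n) 0))"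
    by (rule runs_For[where f = "ruler n" and n = n and g = g, OF _ _ inner])
       (use abc s in \<open>auto simp: g_def fun_eq_iff\<close>)
  moreover have "runs (Rewind c) ((g n)(a := Tape (ruler n) 0)) (3 * (n * m) + 3) s'"
    by (rule runs_Rewind[where f = "ruler (n * m)" and h = "n * m" and n = "n * m"])
       (use abc s s' in \<open>auto simp: g_def fun_eq_iff\<close>)
  \<comment> \<open>The sum \<open>11 n m + 10 n + 7\<close> is at most \<open>28 n m\<close>, since
    \<open>n\<close> and \<open>m\<close> are positive.\<close>
  moreover have "n * (8 * m + 4 + 6) + 4 + (3 * (n * m) + 3) \<le> T"
  proof -
    have "n \<le> n * m" "1 \<le> n * m" using pos by auto
    moreover have "n * (8 * m + 4 + 6) + 4 + (3 * (n * m) + 3) = 11 * (n * m) + 10 * n + 7"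
      by (simp add: algebra_simps)
    ultimately show ?thesis using pos(3) by linarith
  qed
  ultimately show ?thesis
    unfolding MulRuler_def by (rule runs_Seq)
qed

section \<open>Shifted binary addition and subtraction modulo a power of two\<close>

definition carry_out :: "bool \<Rightarrow> nat \<Rightarrow> nat \<Rightarrow> nat \<Rightarrow> nat" where
  "carry_out neg a b c = (if neg then of_bool (a < b + c) else (a + b + c) div 2 mod 2)"

text \<open>For \<open>neg\<close> the carry is a borrow; the new digit has the same formula in both
  cases because signs disappear modulo 2. Digits may spill into cells beyond the first
  \<open>N\<close>, which \<open>val N\<close> does not see.\<close>

fun add_loop :: "bool \<Rightarrow> nat \<Rightarrow> (int \<Rightarrow> nat) \<Rightarrow> (int \<Rightarrow> nat) \<Rightarrow> nat \<Rightarrow> (int \<Rightarrow> nat) \<times> nat" where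
  "add_loop neg k f h 0 = (f, 0)"
| "add_loop neg k f h (Suc m) =
     (case add_loop neg k f h m of (F, c) \<Rightarrow>
        (F(int (k + m) := (F (int (k + m)) + h (int m) + c) mod 2),
         carry_out neg (F (int (k + m))) (h (int m)) c))"

text \<open>
  The carry tape temporarily holds \<open>digit + 2 * carry\<close>, since both depend on the old digit and a
  single instruction writes one tape only.
\<close>

definition addstep :: "nat \<Rightarrow> nat \<Rightarrow> bool \<Rightarrow> prog" where
  "addstep i j neg =
     Seq (Put 6 (\<lambda>r. (r i + r j + r 6) mod 2 + 2 * carry_out neg (r i) (r j) (r 6)) No_Move)
    (Seq (Put i (\<lambda>r. r 6 mod 2) Move_Right)
    (Seq (Put 6 (\<lambda>r. r 6 div 2) No_Move)
         (Mv j Move_Right)))"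

lemma runs_addstep:
  assumes "s i = Tape f x" "s j = Tape h y" "s 6 = Tape ((\<lambda>_. 0)(0 := c)) 0"
    and "i \<noteq> j" "i \<noteq> 6" "j \<noteq> 6"
    and "s' = s(i := Tape (f(x := (f x + h y + c) mod 2)) (x + 1), j := Tape h (y + 1),
          6 := Tape ((\<lambda>_. 0)(0 := carry_out neg (f x) (h y) c)) 0)"
  shows "runs (addstep i j neg) s 4 s'"
proof -
  let ?d = "(f x + h y + c) mod 2" and ?c = "carry_out neg (f x) (h y) c"
  let ?C = "\<lambda>c. Tape ((\<lambda>_. 0)(0 := c)) 0"
  let ?s1 = "s(6 := ?C (?d + 2 * ?c))"
  let ?s2 = "?s1(i := Tape (f(x := ?d)) (x + 1))"
  let ?s3 = "?s2(6 := ?C ?c)"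
  have 1: "runs (Put 6 (\<lambda>r. (r i + r j + r 6) mod 2 + 2 * carry_out neg (r i) (r j) (r 6)) No_Move) s 1 ?s1"
    by (rule runs_Put) (use assms in \<open>auto simp: rd_def read_tape_def\<close>)
  have 2: "runs (Put i (\<lambda>r. r 6 mod 2) Move_Right) ?s1 1 ?s2"
    by (rule runs_Put) (use assms in \<open>auto simp: rd_def read_tape_def\<close>)
  have 3: "runs (Put 6 (\<lambda>r. r 6 div 2) No_Move) ?s2 1 ?s3"
    by (rule runs_Put) (use assms in \<open>auto simp: rd_def read_tape_def\<close>)
  have 4: "runs (Mv j Move_Right) ?s3 1 s'"
    by (rule runs_Mv) (use assms in auto)
  show ?thesis
    unfolding addstep_def
    by (rule runs_Seq[OF 1 runs_Seq[OF 2 runs_Seq[OF 3 4 order_refl] order_refl]]) simp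
qed

text \<open>The digit 0 is the blank, so \<open>Rewind\<close> cannot find the start of a register.
  The heads return by replaying the same rulers leftwards; finally the overflow carry is
  erased.\<close>

definition shift_add :: "nat \<Rightarrow> nat \<Rightarrow> nat \<Rightarrow> bool \<Rightarrow> prog" where
  "shift_add i j r neg =
     Seq (For r (Mv i Move_Right))
    (Seq (For 5 (addstep i j neg))
    (Seq (For 5 (Seq (Mv i Move_Left) (Mv j Move_Left)))
    (Seq (For r (Mv i Move_Left))
         (Put 6 (\<lambda>_. 0) No_Move))))"

lemma runs_shift_add:
  assumes dist: "i \<noteq> j" "i > 6" "j > 6" "r < 5"
    and s: "s i = Tape f 0" "s j = Tape h 0" "s 6 = Tape (\<lambda>_. 0) 0"
      "s r = Tape (ruler k) 0" "s 5 = Tape (ruler N) 0"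
    and s': "s' = s(i := Tape (fst (add_loop neg k f h N)) 0)"
    and T: "k \<le> N" "1 \<le> N" "60 * N \<le> T"
  shows "runs (shift_add i j r neg) s T s'"
proof -
  define F where "F m = fst (add_loop neg k f h m)" for m
  define c where "c m = snd (add_loop neg k f h m)" for m
  have F0: "F 0 = f" "c 0 = 0" by (simp_all add: F_def c_def)
  have FS: "F (Suc m) = (F m)(int k + int m := (F m (int k + int m) + h (int m) + c m) mod 2)"
    "c (Suc m) = carry_out neg (F m (int k + int m)) (h (int m)) (c m)" for m
    by (simp_all add: F_def c_def split: prod.splits)
  define C :: "nat \<Rightarrow> tape" where "C c = Tape ((\<lambda>_. 0)(0 := c)) 0" for c
  have C0: "C 0 = Tape (\<lambda>_. 0) 0" by (simp add: C_def fun_upd_idem)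
  let ?s1 = "s(i := Tape f (int k))"
  let ?s2 = "s(i := Tape (F N) (int k + int N), j := Tape h (int N), 6 := C (c N))"
  let ?s3 = "s(i := Tape (F N) (int k), 6 := C (c N))"
  let ?s4 = "s(i := Tape (F N) 0, 6 := C (c N))"
  have 1: "runs (For r (Mv i Move_Right)) s (k * 7 + 4) ?s1"
    by (rule runs_For[where f = "ruler k" and n = k and T = 1 and
          g = "\<lambda>m. s(r := Tape (ruler k) (int m), i := Tape f (int m))"])
       (use dist s in \<open>auto intro!: runs_Mv simp: fun_eq_iff add.commute\<close>)
  have 2: "runs (For 5 (addstep i j neg)) ?s1 (N * 10 + 4) ?s2"
    by (rule runs_For[where f = "ruler N" and n = N and T = 4 and
          g = "\<lambda>m. s(5 := Tape (ruler N) (int m), i := Tape (F m) (int k + int m), j := Tape h (int m), 6 := C (c m))"])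
       (use dist s in \<open>auto intro!: runs_addstep simp: fun_eq_iff FS F0 C0 C_def ac_simps\<close>)
  define g where "g m = s(5 := Tape (ruler N) (int m), i := Tape (F N) (int k + int N - int m),
      j := Tape h (int N - int m), 6 := C (c N))" for m
  have 3: "runs (For 5 (Seq (Mv i Move_Left) (Mv j Move_Left))) ?s2 (N * 8 + 4) ?s3"
  proof (rule runs_For[where f = "ruler N" and n = N and T = 2 and g = g])
    fix m
    let ?t = "(g m)(i := Tape (F N) (int k + int N - int m - 1))"
    have "runs (Mv i Move_Left) (g m) 1 ?t"
      by (rule runs_Mv[where f = "F N" and h = "int k + int N - int m"]) (use dist in \<open>simp_all add: g_def\<close>)
    moreover have "runs (Mv j Move_Left) ?t 1 ((g (Suc m))(5 := Tape (ruler N) (int m)))"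
      by (rule runs_Mv[where f = h and h = "int N - int m"]) (use dist in \<open>auto simp: g_def fun_eq_iff\<close>)
    ultimately show "runs (Seq (Mv i Move_Left) (Mv j Move_Left)) (g m) 2 ((g (Suc m))(5 := Tape (ruler N) (int m)))"
      by (rule runs_Seq) simp
  qed (use dist s in \<open>auto simp: g_def fun_eq_iff\<close>)
  have 4: "runs (For r (Mv i Move_Left)) ?s3 (k * 7 + 4) ?s4"
    by (rule runs_For[where f = "ruler k" and n = k and T = 1 and
          g = "\<lambda>m. s(r := Tape (ruler k) (int m), i := Tape (F N) (int k - int m), 6 := C (c N))"])
       (use dist s in \<open>auto intro!: runs_Mv simp: fun_eq_iff\<close>)
  have 5: "runs (Put 6 (\<lambda>_. 0) No_Move) ?s4 1 s'"
    by (rule runs_Put) (use dist s in \<open>auto simp: s' F_def C_def fun_eq_iff\<close>)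
  \<comment> \<open>The five phases cost \<open>14 k + 18 N + 17\<close> in total, at most
    \<open>49 N\<close> as \<open>k \<le> N\<close> and \<open>1 \<le> N\<close>.\<close>
  show ?thesis
    unfolding shift_add_def
    by (rule runs_Seq[OF 1 runs_Seq[OF 2 runs_Seq[OF 3 runs_Seq[OF 4 5 order_refl] order_refl] order_refl]])
       (use T in linarith)
qed

definition val :: "nat \<Rightarrow> (int \<Rightarrow> nat) \<Rightarrow> int" where
  "val N f = (\<Sum>m<N. int (f (int m)) * 2 ^ m)"

lemma val_Suc: "val (Suc N) f = val N f + int (f (int N)) * 2 ^ N"
  by (simp add: val_def)

lemma val_upd:
  "m < N \<Longrightarrow> val N (f(int m := d)) = val N f + (int d - int (f (int m))) * 2 ^ m"
proof (induction N)
  case (Suc N)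
  show ?case
  proof (cases "m = N")
    case True
    have "val N (f(int N := d)) = val N f"
      unfolding val_def by (intro sum.cong) auto
    then show ?thesis
      unfolding True val_Suc by (simp add: algebra_simps del: fun_upd_apply) (simp add: algebra_simps)
  qed (use Suc in \<open>simp add: val_Suc\<close>)
qed simp

text \<open>The cells from \<open>N\<close> on have weights divisible by \<open>2 ^ N\<close>, so
  the spill of a shifted addition is harmless.\<close>

lemma val_add_dvd: "2 ^ N dvd val (k + N) f - val N f"
proof (induction k)
  case (Suc k)
  have "2 ^ N dvd (int (f (int (k + N))) * 2 ^ (k + N))"
    by (simp add: power_add)
  with Suc have "2 ^ N dvd (val (k + N) f - val N f) + int (f (int (k + N))) * 2 ^ (k + N)"
    by (rule dvd_add)
  then show ?case by (simp add: val_Suc algebra_simps)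
qed (simp add: val_def)

lemma val_bounds:
  assumes "\<forall>j. f j \<le> 1" shows "0 \<le> val N f" "val N f < 2 ^ N"
proof -
  show "0 \<le> val N f" by (simp add: val_def sum_nonneg)
  show "val N f < 2 ^ N"
  proof (induction N)
    case (Suc N)
    have "int (f (int N)) * 2 ^ N \<le> 1 * 2 ^ N"
      using assms by (intro mult_right_mono) auto
    with Suc show ?case unfolding val_Suc power_Suc by linarith
  qed (simp add: val_def)
qed

lemma val_eq_0: "val N f = 0 \<longleftrightarrow> (\<forall>m<N. f (int m) = 0)"
  unfolding val_def by (subst sum_nonneg_eq_0_iff) auto

lemma add_loop_bits:
  assumes "\<forall>j. f j \<le> 1"
  shows "fst (add_loop neg k f h m) j \<le> 1" "snd (add_loop neg k f h m) \<le> 1"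
proof -
  have "(\<forall>j. fst (add_loop neg k f h m) j \<le> 1) \<and> snd (add_loop neg k f h m) \<le> 1"
    using assms by (induction m) (auto simp: carry_out_def split: prod.splits)
  then show "fst (add_loop neg k f h m) j \<le> 1" "snd (add_loop neg k f h m) \<le> 1"
    by auto
qed

text \<open>Loop invariant: the written digits together with the pending carry, which has weight
  \<open>2 ^ (k + m)\<close>, account exactly for the first \<open>m\<close> digits of
  \<open>h\<close>. The window \<open>k + N\<close> is wide enough to lose nothing.\<close>

lemma add_loop_val:
  assumes bits: "\<forall>j. f j \<le> 1" "\<forall>j. h j \<le> 1" and "m \<le> N"
  shows "val (k + N) (fst (add_loop neg k f h m)) + (if neg then - 1 else 1) * int (snd (add_loop neg k f h m)) * 2 ^ (k + m)
    = val (k + N) f + (if neg then - 1 else 1) * 2 ^ k * val m h"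
  using assms(3)
proof (induction m)
  case 0
  then show ?case by (simp add: val_def)
next
  case (Suc m)
  obtain F c where Fc: "add_loop neg k f h m = (F, c)" by fastforce
  let ?a = "F (int (k + m))" and ?b = "h (int m)"
  have "?a \<le> 1" "c \<le> 1" "?b \<le> 1"
    using add_loop_bits[OF bits(1), of neg k h m] bits(2) by (auto simp: Fc)
  then have "?a = 0 \<or> ?a = 1" "?b = 0 \<or> ?b = 1" "c = 0 \<or> c = 1" by linarith+
  \<comment> \<open>The full adder or subtractor identity for one digit, checked on all eight bit
    patterns.\<close>
  then have digit: "int ((?a + ?b + c) mod 2) + (if neg then - 1 else 1) * 2 * int (carry_out neg ?a ?b c)
      = int ?a + (if neg then - 1 else 1) * (int ?b + int c)"
    by (cases neg) (auto simp: carry_out_def)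
  have "val (k + N) (fst (add_loop neg k f h (Suc m)))
      + (if neg then - 1 else 1) * int (snd (add_loop neg k f h (Suc m))) * 2 ^ (k + Suc m)
    = val (k + N) F + (int ((?a + ?b + c) mod 2) + (if neg then - 1 else 1) * 2 * int (carry_out neg ?a ?b c) - int ?a) * 2 ^ (k + m)"
  proof -
    have "val (k + N) (F(int (k + m) := d)) = val (k + N) F + (int d - int ?a) * 2 ^ (k + m)" for d
      using Suc.prems by (intro val_upd) simp
    then show ?thesis
      by (simp only: Fc add_loop.simps prod.case fst_conv snd_conv) (simp add: algebra_simps)
  qed
  also have "\<dots> = val (k + N) F + (if neg then - 1 else 1) * int c * 2 ^ (k + m) + (if neg then - 1 else 1) * int ?b * 2 ^ (k + m)"
    unfolding digit by (simp add: algebra_simps)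
  also have "\<dots> = val (k + N) f + (if neg then - 1 else 1) * 2 ^ k * val m h + (if neg then - 1 else 1) * int ?b * 2 ^ (k + m)"
    using Suc by (simp add: Fc)
  also have "\<dots> = val (k + N) f + (if neg then - 1 else 1) * 2 ^ k * val (Suc m) h"
    by (simp add: val_Suc algebra_simps power_add)
  finally show ?case .
qed

text \<open>Passing from the window \<open>k + N\<close> to \<open>N\<close> changes values by
  multiples of \<open>2 ^ N\<close>, and the discarded last carry has weight
  \<open>2 ^ (k + N)\<close>.\<close>

lemma add_loop_dvd:
  assumes "\<forall>j. f j \<le> 1" "\<forall>j. h j \<le> 1"
  shows "2 ^ N dvd val N (fst (add_loop neg k f h N)) - (val N f + (if neg then - 1 else 1) * 2 ^ k * val N h)"
proof -
  let ?F = "fst (add_loop neg k f h N)"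
  define e :: int where "e = (if neg then - 1 else 1)"
  have eq: "val N ?F - (val N f + e * 2 ^ k * val N h) =
      (val (k + N) f - val N f) - (val (k + N) ?F - val N ?F) - e * int (snd (add_loop neg k f h N)) * 2 ^ k * 2 ^ N"
    using add_loop_val[where k = k and N = N and neg = neg, OF assms order_refl]
    by (simp add: e_def[symmetric] power_add algebra_simps)
  then show ?thesis
    unfolding e_def[symmetric] eq by (intro dvd_diff val_add_dvd dvd_triv_right)
qed


section \<open>The decision procedure\<close>

lemma wf_Mv [simp]: "wf_prog k S (Mv i d) \<longleftrightarrow> i < k"
  by (auto simp: Mv_def)

lemma wf_Skip [simp]: "wf_prog k S Skip \<longleftrightarrow> 0 < k"
  by (simp add: Skip_def)

lemma wf_Rewind [simp]: "wf_prog k S (Rewind i) \<longleftrightarrow> i < k"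
  by (simp add: Rewind_def)

lemma wf_For [simp]: "wf_prog k S (For i p) \<longleftrightarrow> i < k \<and> wf_prog k S p"
  by (auto simp: For_def)

lemma wf_pushes [simp]: "i < k \<Longrightarrow> 2 \<le> S \<Longrightarrow> wf_prog k S (pushes i n)"
  by (induction n) auto

text \<open>The packed symbol \<open>digit + 2 * carry\<close> can be 3, which explains
  \<open>4 \<le> S\<close>.\<close>

lemma wf_shift_add:
  assumes "i < k" "j < k" "r < k" "6 < k" "4 \<le> S"
  shows "wf_prog k S (shift_add i j r neg)"
proof -
  have *: "a mod 2 + 2 * carry_out neg x y z < S" for a x y z
  proof -
    have "carry_out neg x y z \<le> 1" by (auto simp: carry_out_def)
    moreover have "a mod 2 \<le> 1" by simp
    ultimately show ?thesis using assms(5) by linarith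
  qed
  have "a mod 2 < S" for a :: nat
    using assms(5) by (rule less_le_trans[rotated]) (auto intro: less_trans[of _ 2])
  moreover have "a < S \<Longrightarrow> a div 2 < S" for a :: nat by (rule le_less_trans[OF div_le_dividend])
  ultimately show ?thesis
    using assms * by (auto simp: shift_add_def addstep_def)
qed

definition op_prog :: "op \<Rightarrow> prog" where
  "op_prog = (\<lambda>(i, j, k, s). shift_add (7 + i) (7 + j) (k + 1) s)"

fun ops_prog :: "op list \<Rightarrow> prog" where
  "ops_prog [] = Skip"
| "ops_prog (p # os) = Seq (op_prog p) (ops_prog os)"

text \<open>
  Tape \<open>0\<close> is the input, tape \<open>k + 1\<close> a ruler whose length is the exponent of \<open>kron_point L k\<close> (the ruler
  on tape \<open>1\<close> is empty), tape \<open>5\<close> a ruler of length \<open>L ^ 4\<close>, tape \<open>6\<close> the carry, tape \<open>7 + i\<close>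
  register \<open>i\<close> in binary with the least significant bit in cell \<open>0\<close>, and tape \<open>16\<close> a second copy of
  the ruler of length \<open>L\<close>, needed for nested loops.
\<close>

definition layout :: "tape \<Rightarrow> nat \<Rightarrow> (nat \<Rightarrow> int \<Rightarrow> nat) \<Rightarrow> store" where
  "layout I L F t =
     (if t = 0 then I
      else if 2 \<le> t \<and> t \<le> 5 then Tape (ruler (L ^ (t - 1))) 0
      else if 7 \<le> t \<and> t < 16 then Tape (F (t - 7)) 0
      else if t = 16 then Tape (ruler L) 0
      else Tape (\<lambda>_. 0) 0)"

text \<open>Registers store residues only, so negative values of \<open>V\<close> need no
  sign.\<close>

definition holds :: "nat \<Rightarrow> (nat \<Rightarrow> int \<Rightarrow> nat) \<Rightarrow> (nat \<Rightarrow> int) \<Rightarrow> bool" where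
  "holds L F V \<longleftrightarrow> (\<forall>i<9. (\<forall>j. F i j \<le> 1) \<and> 2 ^ (L ^ 4) dvd val (L ^ 4) (F i) - V i)"

lemma runs_op:
  assumes ok: "op_ok p" and L: "1 \<le> L" and F: "holds L F V"
  shows "\<exists>F'. runs (op_prog p) (layout I L F) (60 * L ^ 4) (layout I L F') \<and>
    holds L F' (op_app (kron_point L) p V)"
proof -
  obtain i j k neg where p: "p = (i, j, k, neg)" by (cases p)
  have ok': "i < 9" "j < 9" "i \<noteq> j" "k < 4" using ok by (auto simp: p op_ok_def)
  define n where "n = (if k = 0 then 0 else L ^ k)"
  define G where "G = fst (add_loop neg n (F i) (F j) (L ^ 4))"
  have bits: "\<forall>x. F i x \<le> 1" "\<forall>x. F j x \<le> 1"
    and dvd: "2 ^ (L ^ 4) dvd val (L ^ 4) (F i) - V i" "2 ^ (L ^ 4) dvd val (L ^ 4) (F j) - V j"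
    using F ok' by (auto simp: holds_def)
  have n: "n \<le> L ^ 4" "1 \<le> L ^ 4"
    using L ok'(4) by (auto simp: n_def intro: power_increasing)
  have "runs (shift_add (7 + i) (7 + j) (k + 1) neg) (layout I L F) (60 * L ^ 4) (layout I L (F(i := G)))"
  proof (rule runs_shift_add[OF _ _ _ _ _ _ _ _ _ _ n order_refl])
    show "layout I L F (k + 1) = Tape (ruler n) 0"
      using ok' by (auto simp: layout_def n_def ruler_0)
    show "layout I L (F(i := G)) = (layout I L F)(7 + i := Tape (fst (add_loop neg n (F i) (F j) (L ^ 4))) 0)"
      using ok' by (auto simp: layout_def G_def fun_eq_iff)
  qed (use ok' in \<open>auto simp: layout_def\<close>)
  moreover have "holds L (F(i := G)) (op_app (kron_point L) p V)"
  proof -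
    have K: "kron_point L k = 2 ^ n" by (simp add: kron_point_def n_def)
    \<comment> \<open>The total error is the error of the addition plus those of its two operands,
      each a multiple of the modulus.\<close>
    have "2 ^ (L ^ 4) dvd (val (L ^ 4) G - (val (L ^ 4) (F i) + sg neg * 2 ^ n * val (L ^ 4) (F j)))
        + (val (L ^ 4) (F i) - V i) + sg neg * 2 ^ n * (val (L ^ 4) (F j) - V j)"
      using add_loop_dvd[OF bits, of "L ^ 4" neg n] dvd
      by (intro dvd_add dvd_mult) (simp_all add: G_def sg_def)
    also have "\<dots> = val (L ^ 4) G - (V i + sg neg * kron_point L k * V j)"
      by (simp add: K algebra_simps)
    finally show ?thesis
      using F ok' add_loop_bits[OF bits(1)] by (auto simp: holds_def p op_app_def G_def)
  qed
  ultimately show ?thesis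
    by (auto simp: p op_prog_def)
qed

lemma runs_ops:
  assumes "\<forall>p\<in>set os. op_ok p" "1 \<le> L" "holds L F V"
  shows "\<exists>F'. runs (ops_prog os) (layout I L F) (length os * (60 * L ^ 4) + 1) (layout I L F') \<and>
    holds L F' (ops_app (kron_point L) os V)"
  using assms(1,3)
proof (induction os arbitrary: F V)
  case Nil
  then show ?case by (intro exI[of _ F]) (simp add: ops_app_def runs_Skip)
next
  case (Cons p os)
  obtain F1 where 1: "runs (op_prog p) (layout I L F) (60 * L ^ 4) (layout I L F1)"
    "holds L F1 (op_app (kron_point L) p V)"
    using runs_op[of p, OF _ assms(2) Cons.prems(2)] Cons.prems(1) by (metis list.set_intros(1))
  obtain F2 where 2: "runs (ops_prog os) (layout I L F1) (length os * (60 * L ^ 4) + 1) (layout I L F2)"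
    "holds L F2 (ops_app (kron_point L) os (op_app (kron_point L) p V))"
    using Cons.IH[OF _ 1(2)] Cons.prems(1) by auto
  have "runs (ops_prog (p # os)) (layout I L F) (length (p # os) * (60 * L ^ 4) + 1) (layout I L F2)"
    unfolding ops_prog.simps by (rule runs_Seq[OF 1(1) 2(1)]) simp
  then show ?case
    using 2(2) by (auto simp: ops_app_def)
qed

definition letter_prog :: "nat \<Rightarrow> prog" where
  "letter_prog b =
     Cond (\<lambda>r. r 0 = 1) (ops_prog (letter_ops b Lit_a))
    (Cond (\<lambda>r. r 0 = 2) (ops_prog (letter_ops b Lit_a_inv))
    (Cond (\<lambda>r. r 0 = 3) (ops_prog (letter_ops b Lit_b)) (ops_prog (letter_ops b Lit_b_inv))))"

lemma runs_letter:
  assumes "b \<in> {0, 4}" "1 \<le> L" "holds L F V" "f x = letter_code l"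
  shows "\<exists>F'. runs (letter_prog b) (layout (Tape f x) L F) (730 * L ^ 4) (layout (Tape f x) L F') \<and>
    holds L F' (ops_app (kron_point L) (letter_ops b l) V)"
proof -
  have "\<forall>p\<in>set (letter_ops b l). op_ok p"
    using op_ok_letter[OF assms(1)] by blast
  then obtain F' where
    F': "runs (ops_prog (letter_ops b l)) (layout (Tape f x) L F)
       (length (letter_ops b l) * (60 * L ^ 4) + 1) (layout (Tape f x) L F')"
    "holds L F' (ops_app (kron_point L) (letter_ops b l) V)"
    using runs_ops[OF _ assms(2,3)] by blast
  have "length (letter_ops b l) * (60 * L ^ 4) \<le> 12 * (60 * L ^ 4)"
    using length_letter_ops by (intro mult_right_mono) auto
  moreover have "1 \<le> L ^ 4" using assms(2) by simp
  \<comment> \<open>Twelve operations give \<open>720 * L ^ 4\<close>; the closing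
    \<open>Skip\<close> costs 1 and the nested tests at most 4.\<close>
  ultimately have T: "length (letter_ops b l) * (60 * L ^ 4) + 1 + 4 \<le> 730 * L ^ 4"
    by linarith
  have r: "rd (layout (Tape f x) L F) 0 = letter_code l"
    by (simp add: rd_def read_tape_def layout_def assms(4))
  note F1 = F'(1)
  have "runs (letter_prog b) (layout (Tape f x) L F) (length (letter_ops b l) * (60 * L ^ 4) + 1 + 4)
      (layout (Tape f x) L F')"
  proof (cases l)
    case Lit_a
    show ?thesis
      unfolding letter_prog_def
      by (rule runs_Cond_True[OF _ F1[unfolded Lit_a]]) (use r Lit_a in simp_all)
  next
    case Lit_a_inv
    show ?thesis
      unfolding letter_prog_def
      by (rule runs_Cond_False[OF _ runs_Cond_True[OF _ F1[unfolded Lit_a_inv] order_refl]])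
         (use r Lit_a_inv in simp_all)
  next
    case Lit_b
    show ?thesis
      unfolding letter_prog_def
      by (rule runs_Cond_False[OF _ runs_Cond_False[OF _ runs_Cond_True[OF _ F1[unfolded Lit_b] order_refl] order_refl]])
         (use r Lit_b in simp_all)
  next
    case Lit_b_inv
    show ?thesis
      unfolding letter_prog_def
      by (rule runs_Cond_False[OF _ runs_Cond_False[OF _ runs_Cond_False[OF _ F1[unfolded Lit_b_inv] order_refl] order_refl]])
         (use r Lit_b_inv in simp_all)
  qed
  then show ?thesis
    using F'(2) runs_mono[OF _ T] by blast
qed

section \<open>Reading a word, setting up the tapes and testing for zero\<close>

definition word_prog :: "nat \<Rightarrow> prog" where
  "word_prog b = While (\<lambda>r. r 0 \<noteq> 0 \<and> r 0 \<noteq> 5) (Seq (letter_prog b) (Mv 0 Move_Right))"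

lemma layout_move: "(layout (Tape f x) L F)(0 := Tape f y) = layout (Tape f y) L F"
  by (auto simp: layout_def)

text \<open>One loop serves both words, as \<open>v\<close> ends at the separator 5 and
  \<open>w\<close> at the first blank. The start cell \<open>x\<close> is arbitrary for the sake of
  the second word and of the induction.\<close>

lemma runs_word:
  assumes b: "b \<in> {0, 4}" and L: "1 \<le> L" and F: "holds L F V"
    and f: "\<And>m. m < length w \<Longrightarrow> f (x + int m) = letter_code (w ! m)"
    and stop: "f (x + int (length w)) \<in> {0, 5}"
  shows "\<exists>F'. runs (word_prog b) (layout (Tape f x) L F) (length w * (740 * L ^ 4) + 1)
      (layout (Tape f (x + int (length w))) L F') \<and>
    holds L F' (ops_app (kron_point L) (word_ops b w) V)"
  using F f stop
proof (induction w arbitrary: x F V)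
  case Nil
  then have "runs (word_prog b) (layout (Tape f x) L F) 1 (layout (Tape f x) L F)"
    unfolding word_prog_def by (intro runs_While_False) (auto simp: rd_def read_tape_def layout_def)
  with Nil show ?case by (auto simp: word_ops_def ops_app_def)
next
  case (Cons l w)
  have fx: "f x = letter_code l" using Cons.prems(2)[of 0] by simp
  obtain F1 where 1: "runs (letter_prog b) (layout (Tape f x) L F) (730 * L ^ 4) (layout (Tape f x) L F1)"
    "holds L F1 (ops_app (kron_point L) (letter_ops b l) V)"
    using runs_letter[where f = f and x = x and l = l, OF b L Cons.prems(1) fx] by blast
  have shift: "f (x + 1 + int m) = letter_code (w ! m)" if "m < length w" for m
    using Cons.prems(2)[of "Suc m"] that by (simp add: add.assoc)
  have "f (x + 1 + int (length w)) \<in> {0, 5}"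
    using Cons.prems(3) by (simp add: add.assoc)
  with Cons.IH[OF 1(2), where x = "x + 1"] shift obtain F2 where
    2: "runs (word_prog b) (layout (Tape f (x + 1)) L F1) (length w * (740 * L ^ 4) + 1)
      (layout (Tape f (x + 1 + int (length w))) L F2)"
    "holds L F2 (ops_app (kron_point L) (word_ops b w) (ops_app (kron_point L) (letter_ops b l) V))"
    by blast
  have mv: "runs (Mv 0 Move_Right) (layout (Tape f x) L F1) 1 (layout (Tape f (x + 1)) L F1)"
    by (rule runs_Mv[where f = f and h = x]) (simp_all add: layout_move, simp add: layout_def)
  have "letter_code l \<noteq> 0 \<and> letter_code l \<noteq> 5" by (cases l) auto
  then have guard: "rd (layout (Tape f x) L F) 0 \<noteq> 0 \<and> rd (layout (Tape f x) L F) 0 \<noteq> 5"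
    by (simp add: rd_def read_tape_def layout_def fx)
  have "1 \<le> L ^ 4" using L by simp
  then have T: "730 * L ^ 4 + 1 + 2 + (length w * (740 * L ^ 4) + 1) \<le> length (l # w) * (740 * L ^ 4) + 1"
    by simp
  have "runs (word_prog b) (layout (Tape f x) L F) (length (l # w) * (740 * L ^ 4) + 1)
      (layout (Tape f (x + 1 + int (length w))) L F2)"
    unfolding word_prog_def
    by (rule runs_While_True[where s = "layout (Tape f x) L F", OF guard runs_Seq[OF 1(1) mv order_refl]
          2(1)[unfolded word_prog_def] T])
  moreover have "ops_app (kron_point L) (word_ops b w) (ops_app (kron_point L) (letter_ops b l) V) =
      ops_app (kron_point L) (word_ops b (l # w)) V"
    by (simp add: word_ops_def ops_app_def)
  ultimately show ?case
    using 2(2) by (auto simp: add.assoc)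
qed

text \<open>Sixteen marks per input cell, separator included, give two rulers of length
  \<open>size_param v w\<close>; three multiplications make the longer ones. The last two writes set
  registers 0 and 4 to 1, as in \<open>reg0\<close>.\<close>

definition setup_prog :: prog where
  "setup_prog =
     Seq (For 0 (Seq (pushes 2 16) (pushes 16 16)))
    (Seq (Rewind 2)
    (Seq (Rewind 16)
    (Seq (MulRuler 2 16 3)
    (Seq (MulRuler 3 16 4)
    (Seq (MulRuler 4 16 5)
    (Seq (Put 7 (\<lambda>_. 1) No_Move) (Put 11 (\<lambda>_. 1) No_Move)))))))"

definition init_bits :: "nat \<Rightarrow> int \<Rightarrow> nat" where
  "init_bits i = (\<lambda>_. 0)(0 := (if i = 0 \<or> i = 4 then 1 else 0))"

lemma holds_init: "1 \<le> L \<Longrightarrow> holds L init_bits reg0"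
proof -
  assume "1 \<le> L"
  then have "0 < L ^ 4" by simp
  have "val (L ^ 4) ((\<lambda>_. 0)(int 0 := c)) = int c" for c
    by (subst val_upd[OF \<open>0 < L ^ 4\<close>]) (simp add: val_def)
  then show ?thesis
    by (auto simp: holds_def init_bits_def reg0_def)
qed

lemma runs_setup:
  assumes f: "strip f n" and n: "1 \<le> n" and L: "L = 16 * n"
  shows "runs setup_prog (\<lambda>i. if i = 0 then Tape f 0 else Tape (\<lambda>_. 0) 0) (200 * L ^ 4)
    (layout (Tape f 0) L init_bits)"
proof -
  define s :: store where "s = (\<lambda>i. if i = 0 then Tape f 0 else Tape (\<lambda>_. 0) 0)"
  define R where "R k = Tape (ruler k) 0" for k
  define s1 where "s1 = s(2 := Tape (ruler L) (int L), 16 := Tape (ruler L) (int L))"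
  define s2 where "s2 = s(2 := R L, 16 := Tape (ruler L) (int L))"
  define s3 where "s3 = s(2 := R L, 16 := R L)"
  define s4 where "s4 = s3(3 := R (L * L))"
  define s5 where "s5 = s4(4 := R (L * L * L))"
  define s6 where "s6 = s5(5 := R (L * L * L * L))"
  define s7 where "s7 = s6(7 := Tape ((\<lambda>_. 0)(0 := 1)) 0)"
  have s0: "s i = R 0" if "i \<noteq> 0" for i
    using that by (simp add: s_def R_def ruler_0)
  have L1: "1 \<le> L" using n by (simp add: L)
  then have L1: "1 \<le> L" "L \<le> L ^ 4" using power_increasing[of 1 4 L] by simp_all
  have L4: "L * L * L * L = L ^ 4" by (simp add: power4_eq_xxxx)
  have L2: "1 \<le> L * L" "1 \<le> L * L * L" "L * L \<le> L ^ 4" "L * L * L \<le> L ^ 4"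
    using L1(1) unfolding L4[symmetric] by auto
  define g where "g m = s(0 := Tape f (int m), 2 := Tape (ruler (16 * m)) (int (16 * m)),
      16 := Tape (ruler (16 * m)) (int (16 * m)))" for m
  have 1: "runs (For 0 (Seq (pushes 2 16) (pushes 16 16))) s (n * 40 + 4) s1"
  proof (rule runs_For[where f = f and n = n and g = g and T = 34, OF f])
    show "g m 0 = Tape f (int m)" for m by (simp add: g_def)
    fix m
    let ?h = "(g m)(2 := Tape (ruler (16 * m + 16)) (int (16 * m + 16)))"
    have "runs (pushes 2 16) (g m) 17 ?h"
      by (rule runs_pushes[where k = "16 * m"]) (auto simp: g_def fun_eq_iff)
    moreover have "runs (pushes 16 16) ?h 17 ((g (Suc m))(0 := Tape f (int m)))"
      by (rule runs_pushes[where k = "16 * m"]) (auto simp: g_def fun_eq_iff add.commute)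
    ultimately show "runs (Seq (pushes 2 16) (pushes 16 16)) (g m) 34 ((g (Suc m))(0 := Tape f (int m)))"
      by (rule runs_Seq) simp
  next
    show "s = g 0"
      by (auto simp: g_def s_def ruler_0 fun_eq_iff)
    show "s1 = (g n)(0 := Tape f 0)"
      by (auto simp: g_def s1_def s_def L fun_eq_iff)
  qed simp
  have 2: "runs (Rewind 2) s1 (3 * L + 3) s2"
    by (rule runs_Rewind[where f = "ruler L" and h = L and n = L]) (auto simp: s1_def s2_def R_def fun_eq_iff)
  have 3: "runs (Rewind 16) s2 (3 * L + 3) s3"
    by (rule runs_Rewind[where f = "ruler L" and h = L and n = L]) (auto simp: s2_def s3_def R_def fun_eq_iff)
  have 4: "runs (MulRuler 2 16 3) s3 (40 * L ^ 4) s4"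
    by (rule runs_MulRuler[where n = L and m = L])
       (use L1 L2 in \<open>auto simp: s3_def s4_def s0 R_def[symmetric]\<close>)
  have 5: "runs (MulRuler 3 16 4) s4 (40 * L ^ 4) s5"
    by (rule runs_MulRuler[where n = "L * L" and m = L])
       (use L1 L2 in \<open>auto simp: s3_def s4_def s5_def s0 R_def[symmetric]\<close>)
  have 6: "runs (MulRuler 4 16 5) s5 (40 * L ^ 4) s6"
    by (rule runs_MulRuler[where n = "L * L * L" and m = L])
       (use L1 L2 L4 in \<open>auto simp: s3_def s4_def s5_def s6_def s0 R_def[symmetric]\<close>)
  have 7: "runs (Put 7 (\<lambda>_. 1) No_Move) s6 1 s7"
    by (rule runs_Put) (auto simp: s7_def s6_def s5_def s4_def s3_def s_def)
  have 8: "runs (Put 11 (\<lambda>_. 1) No_Move) s7 1 (layout (Tape f 0) L init_bits)"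
  proof (rule runs_Put)
    have "layout (Tape f 0) L init_bits i = (s7(11 := Tape ((\<lambda>_. 0)(0 := 1)) 0)) i" for i
    proof -
      consider "i = 0" | "i = 2" | "i = 3" | "i = 4" | "i = 5" | "i = 7" | "i = 11" | "i = 16"
        | "i \<notin> {0, 2, 3, 4, 5, 7, 11, 16}" by blast
      then show ?thesis
      proof cases
        case 9
        then show ?thesis
          by (auto simp: layout_def s7_def s6_def s5_def s4_def s3_def s_def init_bits_def fun_upd_idem)
      qed (simp_all add: layout_def s7_def s6_def s5_def s4_def s3_def s_def init_bits_def R_def
          power2_eq_square power3_eq_cube power4_eq_xxxx)
    qed
    then show "layout (Tape f 0) L init_bits = s7(11 := act_tape (1, No_Move) (s7 11))"
      by (auto simp: s7_def s6_def s5_def s4_def s3_def s_def fun_eq_iff)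
  qed simp
  have "16 * n \<le> L ^ 4" "1 \<le> L ^ 4" using L1 L by auto
  then have T: "n * 40 + 4 + (3 * L + 3 + (3 * L + 3 + (40 * L ^ 4 + (40 * L ^ 4 + (40 * L ^ 4 + (1 + 1))))))
      \<le> 200 * L ^ 4"
    using L1(2) by linarith
  show ?thesis
    unfolding setup_prog_def s_def[symmetric]
    by (rule runs_Seq[OF 1 runs_Seq[OF 2 runs_Seq[OF 3 runs_Seq[OF 4 runs_Seq[OF 5 runs_Seq[OF 6 runs_Seq[OF 7 8
          order_refl] order_refl] order_refl] order_refl] order_refl] order_refl] T])
qed

text \<open>Tape 15 holds register 8. The carry tape 6, blank at this point, becomes the flag on
  which the verdict is based.\<close>

definition zero_test :: prog where
  "zero_test = For 5 (Seq (Put 6 (\<lambda>r. if r 15 = 0 then r 6 else 1) No_Move) (Mv 15 Move_Right))"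

lemma runs_zero_test:
  assumes "s 5 = Tape (ruler N) 0" "s 6 = Tape (\<lambda>_. 0) 0" "s 15 = Tape f 0"
  shows "\<exists>s'. runs zero_test s (8 * N + 4) s' \<and> (rd s' 6 = 0 \<longleftrightarrow> (\<forall>m<N. f (int m) = 0))"
proof -
  define c where "c m = (if \<forall>j<m. f (int j) = 0 then 0 else 1 :: nat)" for m
  have c: "c 0 = 0" "c (Suc m) = (if f (int m) = 0 then c m else 1)" for m
    by (auto simp: c_def less_Suc_eq)
  define C :: "nat \<Rightarrow> tape" where "C x = Tape ((\<lambda>_. 0)(0 := x)) 0" for x
  define g where "g m = s(5 := Tape (ruler N) (int m), 6 := C (c m), 15 := Tape f (int m))" for m
  have "runs zero_test s (8 * N + 4) ((g N)(5 := Tape (ruler N) 0))"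
    unfolding zero_test_def
  proof (rule runs_For[where f = "ruler N" and n = N and T = 2 and g = g])
    fix m
    let ?h = "(g m)(6 := C (c (Suc m)))"
    have "runs (Put 6 (\<lambda>r. if r 15 = 0 then r 6 else 1) No_Move) (g m) 1 ?h"
      by (rule runs_Put) (auto simp: g_def C_def c rd_def read_tape_def)
    moreover have "runs (Mv 15 Move_Right) ?h 1 ((g (Suc m))(5 := Tape (ruler N) (int m)))"
      by (rule runs_Mv[where f = f and h = "int m"]) (auto simp: g_def fun_eq_iff)
    ultimately show "runs (Seq (Put 6 (\<lambda>r. if r 15 = 0 then r 6 else 1) No_Move) (Mv 15 Move_Right))
        (g m) 2 ((g (Suc m))(5 := Tape (ruler N) (int m)))"
      by (rule runs_Seq) simp
  qed (use assms in \<open>auto simp: g_def c C_def fun_eq_iff fun_upd_idem\<close>)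
  moreover have "rd ((g N)(5 := Tape (ruler N) 0)) 6 = c N"
    by (simp add: rd_def read_tape_def g_def C_def)
  ultimately show ?thesis
    by (intro exI[of _ "(g N)(5 := Tape (ruler N) 0)"]) (auto simp: c_def)
qed

section \<open>The complete program, its correctness and its running time\<close>

definition main_prog :: prog where
  "main_prog =
     Seq setup_prog
    (Seq (word_prog 0)
    (Seq (Mv 0 Move_Right)
    (Seq (word_prog 4)
    (Seq (ops_prog (trace_ops 0 False @ trace_ops 4 True))
         zero_test))))"

lemma wf_ops_prog: "\<forall>p\<in>set os. op_ok p \<Longrightarrow> wf_prog 17 6 (ops_prog os)"
  by (induction os) (auto simp: op_prog_def op_ok_def intro!: wf_shift_add)

lemma wf_main_prog: "wf_prog 17 6 main_prog"
proof -
  have "wf_prog 17 6 (ops_prog (letter_ops b l))" if "b \<in> {0, 4}" for b l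
    using op_ok_letter[OF that] by (intro wf_ops_prog) blast
  moreover have "\<forall>p\<in>set (trace_ops 0 False @ trace_ops 4 True). op_ok p"
    by (auto simp: trace_ops_def op_ok_def)
  ultimately show ?thesis
    using wf_ops_prog
    by (simp add: main_prog_def setup_prog_def MulRuler_def word_prog_def letter_prog_def zero_test_def
        del: letter_ops.simps pushes.simps)
qed

lemma runs_main:
  fixes v w :: word
  defines "L \<equiv> size_param v w"
  shows "\<exists>s'. runs main_prog (\<lambda>i. if i = 0 then input_tape (encode_pair v w) else input_tape [])
      (1000 * L ^ 5) s' \<and> (rd s' 6 = 0 \<longleftrightarrow> char_equiv v w)"
proof -
  define xs where "xs = encode_pair v w"
  define f where "f i = (if 0 \<le> i \<and> nat i < length xs then xs ! nat i else 0)" for i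
  have tapes: "input_tape xs = Tape f 0" "input_tape [] = Tape (\<lambda>_. 0) 0"
    by (auto simp: input_tape_def f_def)
  have len: "length xs = length v + length w + 1" by (simp add: xs_def encode_pair_def)
  have "x \<noteq> 0" if "x \<in> set xs" for x
  proof -
    have "letter_code l \<noteq> 0" for l by (cases l) auto
    then show ?thesis using that by (auto simp: xs_def encode_pair_def)
  qed
  then have strip: "strip f (length xs)"
    unfolding strip_def f_def by (auto simp: nat_less_iff)
  have L: "L = 16 * length xs" "1 \<le> L" by (simp_all add: L_def size_param_def len)
  have nth: "f (int m) = (if m < length xs then xs ! m else 0)" for m
    by (simp add: f_def)
  have xs: "xs = map letter_code v @ 5 # map letter_code w"
    by (simp add: xs_def encode_pair_def)
  have fv: "f (0 + int m) = letter_code (v ! m)" if "m < length v" for m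
    using that nth[of m] by (simp add: xs nth_append)
  have f5: "f (0 + int (length v)) \<in> {0, 5}"
    using nth[of "length v"] by (simp add: xs nth_append)
  have fw: "f (int (length v) + 1 + int m) = letter_code (w ! m)" if "m < length w" for m
    using that nth[of "length v + 1 + m"] by (simp add: xs nth_append algebra_simps)
  have f0: "f (int (length v) + 1 + int (length w)) \<in> {0, 5}"
    using nth[of "length v + 1 + length w"] by (simp add: len algebra_simps)
  let ?X = "kron_point L"
  have "1 \<le> length xs" by (simp add: len)
  note 1 = runs_setup[OF strip this L(1)]
  obtain F2 where 2: "runs (word_prog 0) (layout (Tape f 0) L init_bits) (length v * (740 * L ^ 4) + 1)
      (layout (Tape f (0 + int (length v))) L F2)"
    "holds L F2 (ops_app ?X (word_ops 0 v) reg0)"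
    using runs_word[OF _ L(2) holds_init[OF L(2)] fv f5, of 0] by auto
  \<comment> \<open>Steps over the separator, at which the first word loop stops.\<close>
  have 3: "runs (Mv 0 Move_Right) (layout (Tape f (0 + int (length v))) L F2) 1
      (layout (Tape f (int (length v) + 1)) L F2)"
    by (rule runs_Mv[where f = f and h = "int (length v)"]) (simp_all add: layout_move, simp add: layout_def)
  obtain F4 where 4: "runs (word_prog 4) (layout (Tape f (int (length v) + 1)) L F2) (length w * (740 * L ^ 4) + 1)
      (layout (Tape f (int (length v) + 1 + int (length w))) L F4)"
    "holds L F4 (ops_app ?X (word_ops 4 w) (ops_app ?X (word_ops 0 v) reg0))"
    using runs_word[OF _ L(2) 2(2) fw f0, of 4] by auto
  have "\<forall>p\<in>set (trace_ops 0 False @ trace_ops 4 True). op_ok p"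
    by (auto simp: trace_ops_def op_ok_def)
  from runs_ops[OF this L(2) 4(2)] obtain F5 where
    5: "runs (ops_prog (trace_ops 0 False @ trace_ops 4 True)) (layout (Tape f (int (length v) + 1 + int (length w))) L F4)
      (length (trace_ops 0 False @ trace_ops 4 True) * (60 * L ^ 4) + 1)
      (layout (Tape f (int (length v) + 1 + int (length w))) L F5)"
    "holds L F5 (ops_app ?X (trace_ops 0 False @ trace_ops 4 True)
      (ops_app ?X (word_ops 4 w) (ops_app ?X (word_ops 0 v) reg0)))"
    by blast
  have F5: "holds L F5 (ops_app ?X (pair_ops v w) reg0)"
    using 5(2) by (simp add: pair_ops_def ops_app_def)
  have "layout I L F5 5 = Tape (ruler (L ^ 4)) 0" "layout I L F5 6 = Tape (\<lambda>_. 0) 0"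
    "layout I L F5 15 = Tape (F5 8) 0" for I
    by (simp_all add: layout_def)
  from runs_zero_test[where s = "layout (Tape f (int (length v) + 1 + int (length w))) L F5", OF this] obtain s' where
    6: "runs zero_test (layout (Tape f (int (length v) + 1 + int (length w))) L F5) (8 * L ^ 4 + 4) s'"
    "rd s' 6 = 0 \<longleftrightarrow> (\<forall>m<L ^ 4. F5 8 (int m) = 0)"
    by (elim exE conjE) (rule that)
  have T: "200 * L ^ 4 + (length v * (740 * L ^ 4) + 1 + (1 + (length w * (740 * L ^ 4) + 1 +
      (length (trace_ops 0 False @ trace_ops 4 True) * (60 * L ^ 4) + 1 + (8 * L ^ 4 + 4))))) \<le> 1000 * L ^ 5"
  proof -
    \<comment> \<open>As \<open>L\<close> is 16 times the input length, \<open>L ^ 5\<close> splits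
      into products that \<open>linarith\<close> treats as atoms; the \<open>740 * L ^ 4\<close> per
      letter is paid out of \<open>16 * 1000 * L ^ 4\<close>.\<close>
    have "L * K = 16 * (length v * K) + 16 * (length w * K) + 16 * K" for K
      unfolding L(1) len by (simp add: algebra_simps)
    moreover have "L ^ 5 = L * L ^ 4" by (simp add: eval_nat_numeral)
    ultimately have "L ^ 5 = 16 * (length v * L ^ 4) + 16 * (length w * L ^ 4) + 16 * L ^ 4"
      by (simp only:)
    moreover have "length v * (740 * L ^ 4) = 740 * (length v * L ^ 4)"
      "length w * (740 * L ^ 4) = 740 * (length w * L ^ 4)" by simp_all
    moreover have "length (trace_ops 0 False @ trace_ops 4 True) * (60 * L ^ 4) = 600 * L ^ 4"
      by (simp add: trace_ops_def)
    moreover have "1 \<le> L ^ 4" using L(2) by simp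
    ultimately show ?thesis by linarith
  qed
  have "runs main_prog (\<lambda>i. if i = 0 then input_tape xs else input_tape []) (1000 * L ^ 5) s'"
    unfolding main_prog_def tapes
    by (rule runs_Seq[OF 1 runs_Seq[OF 2(1) runs_Seq[OF 3 runs_Seq[OF 4(1) runs_Seq[OF 5(1) 6(1)
          order_refl] order_refl] order_refl] order_refl] T])
  moreover have "rd s' 6 = 0 \<longleftrightarrow> char_equiv v w"
  proof -
    have "\<forall>j. F5 8 j \<le> 1" and d: "2 ^ (L ^ 4) dvd val (L ^ 4) (F5 8) - ops_app ?X (pair_ops v w) reg0 8"
      using F5 by (auto simp: holds_def)
    note b = val_bounds[OF this(1), of "L ^ 4"]
    have "rd s' 6 = 0 \<longleftrightarrow> val (L ^ 4) (F5 8) = 0"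
      by (simp add: 6(2) val_eq_0)
    \<comment> \<open>The stored number lies between 0 and the modulus, so only 0 is
      divisible.\<close>
    also have "\<dots> \<longleftrightarrow> 2 ^ (L ^ 4) dvd val (L ^ 4) (F5 8)"
      using b zdvd_not_zless[of "val (L ^ 4) (F5 8)" "2 ^ (L ^ 4)"] by (cases "val (L ^ 4) (F5 8) = 0") auto
    also have "\<dots> \<longleftrightarrow> 2 ^ (L ^ 4) dvd ops_app ?X (pair_ops v w) reg0 8"
      using dvd_add_right_iff[OF d, of "ops_app ?X (pair_ops v w) reg0 8"] by simp
    also have "\<dots> \<longleftrightarrow> char_equiv v w"
      unfolding L_def by (rule char_equiv_iff_dvd[symmetric])
    finally show ?thesis .
  qed
  ultimately show ?thesis
    unfolding xs_def by (intro exI conjI)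
qed

theorem corollary1p9:
  "\<exists>(M :: tm) (T :: nat \<Rightarrow> nat).
     wf_tm M \<and>
     (\<lambda>n. real (T n)) \<in> O(\<lambda>n. real n ^ 5) \<and>
     (\<forall>(n :: nat) (v :: word) (w :: word).
        freely_reduced v \<and> freely_reduced w \<and> length v \<le> n \<and> length w \<le> n \<longrightarrow>
        answers_within M (encode_pair v w) (char_equiv v w) (T n))"
proof (intro exI conjI allI impI)
  \<comment> \<open>The machine uses tapes 0 to 16 and six symbols and judges by tape 6. The bound
    uses that \<open>size_param v w\<close> is at most \<open>16 * (2 * n + 1)\<close>; the final 1
    is the verdict step.\<close>
  let ?M = "machine 17 6 6 main_prog" and ?T = "\<lambda>n. 1000 * (16 * (2 * n + 1)) ^ 5 + 1"
  show "wf_tm ?M"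
    by (rule wf_machine[OF wf_main_prog]) auto
  show "(\<lambda>n. real (?T n)) \<in> O(\<lambda>n. real n ^ 5)"
  proof (rule bigoI[where c = "1000 * 48 ^ 5 + 1"], rule eventually_sequentiallyI[of 1])
    fix n :: nat assume n: "1 \<le> n"
    \<comment> \<open>For \<open>n \<ge> 1\<close> one has \<open>2 * n + 1 \<le> 3 * n\<close>,
      whence 48; the extra 1 in \<open>?T\<close> is absorbed by \<open>n ^ 5\<close>.\<close>
    have "(16 * (2 * n + 1)) ^ 5 \<le> (48 * n) ^ 5"
      using n by (intro power_mono) auto
    moreover have "1 \<le> n ^ 5" using n by simp
    ultimately have "?T n \<le> 1000 * (48 * n) ^ 5 + n ^ 5"
      by linarith
    also have "\<dots> = (1000 * 48 ^ 5 + 1) * n ^ 5"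
      by (simp add: power_mult_distrib)
    finally have "?T n \<le> \<dots>" .
    then have "real (?T n) \<le> real ((1000 * 48 ^ 5 + 1) * n ^ 5)"
      by (rule of_nat_mono)
    then show "norm (real (?T n)) \<le> (1000 * 48 ^ 5 + 1) * norm (real n ^ 5)"
      by simp
  qed
  fix n :: nat and v w :: word
  assume *: "freely_reduced v \<and> freely_reduced w \<and> length v \<le> n \<and> length w \<le> n"
  obtain s' t where t: "t \<le> 1000 * size_param v w ^ 5"
    "exec main_prog (\<lambda>i. if i = 0 then input_tape (encode_pair v w) else input_tape []) t s'"
    and eq: "rd s' 6 = 0 \<longleftrightarrow> char_equiv v w"
    using runs_main[of v w] by (auto elim!: runsE)
  have "answers_within ?M (encode_pair v w) (char_equiv v w) (t + 1)"
    using machine_answers[OF wf_main_prog _ _ t(2), of 6] by (simp add: eq)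
  moreover have "t + 1 \<le> ?T n"
  proof -
    have "size_param v w ^ 5 \<le> (16 * (2 * n + 1)) ^ 5"
      using * by (intro power_mono) (auto simp: size_param_def)
    then show ?thesis using t(1) by linarith
  qed
  ultimately show "answers_within ?M (encode_pair v w) (char_equiv v w) (?T n)"
    unfolding answers_within_def by (meson order_trans)
qed

end
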